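(* Let $\zeta$ be a smooth harmonic unit vector field defined on all of $\mathbb{S}^3$ whose integral curves are great circles. Then $\zeta$ is a Hopf vector field.
   Context: $\mathbb{S}^3\subset\mathbb{R}^4$ carries the round metric with Levi-Civita connection $\nabla$. A unit vector field $\zeta$ is harmonic if $\Delta\zeta+|\nabla\zeta|^2\zeta=0$, where $\Delta\zeta=\operatorname{trace}\nabla^2\zeta$ is the rough Laplacian. A Hopf vector field on $\mathbb{S}^3$ is a vector field of the form $\zeta(p)=\mathcal{J}p$, where $\mathcal{J}$ is a linear map of $\mathbb{R}^4$ with $\mathcal{J}\in O(4)$ and $\mathcal{J}^2=-I$. *)

theory Defs
  imports "HOL-Analysis.Analysis"
begin

text \<open>C^k and C^infinity maps between Euclidean spaces on a set (intended: open set),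
  via iterated directional (Frechet) derivatives.\<close>
fun Ck_on :: "nat \<Rightarrow> 'a::euclidean_space set \<Rightarrow> ('a \<Rightarrow> 'b::euclidean_space) \<Rightarrow> bool" where
  "Ck_on 0 S f = continuous_on S f"
| "Ck_on (Suc k) S f = (f differentiable_on S \<and>
      (\<forall>v. Ck_on k S (\<lambda>x. frechet_derivative f (at x) v)))"

definition smooth_on :: "'a::euclidean_space set \<Rightarrow> ('a \<Rightarrow> 'b::euclidean_space) \<Rightarrow> bool" where
  "smooth_on S f \<longleftrightarrow> (\<forall>k. Ck_on k S f)"

abbreviation S3 :: "(real^4) set" where "S3 \<equiv> sphere 0 1"

definition smooth_unit_field_S3 :: "(real^4 \<Rightarrow> real^4) \<Rightarrow> bool" where
  "smooth_unit_field_S3 \<zeta> \<longleftrightarrow>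
     (\<exists>U F. open U \<and> S3 \<subseteq> U \<and> smooth_on U F \<and> (\<forall>p\<in>S3. F p = \<zeta> p)) \<and>
     (\<forall>p\<in>S3. \<zeta> p \<bullet> p = 0 \<and> norm (\<zeta> p) = 1)"

definition tproj :: "real^4 \<Rightarrow> real^4 \<Rightarrow> real^4" where
  "tproj p w = w - (w \<bullet> p) *\<^sub>R p"

definition geod :: "real^4 \<Rightarrow> real^4 \<Rightarrow> real \<Rightarrow> real^4" where
  "geod p v t = cos t *\<^sub>R p + sin t *\<^sub>R v"

definition cov :: "(real^4 \<Rightarrow> real^4) \<Rightarrow> real^4 \<Rightarrow> real^4 \<Rightarrow> real^4" where
  "cov \<zeta> p v = tproj p (vector_derivative (\<lambda>t. \<zeta> (geod p v t)) (at 0))"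

text \<open>Second covariant derivative nabla^2 zeta (v,v) at p, for v a unit tangent vector at p:
  covariant derivative along the geodesic of nabla_{gamma'} zeta (the geodesic has
  nabla_{gamma'} gamma' = 0).\<close>
definition hess :: "(real^4 \<Rightarrow> real^4) \<Rightarrow> real^4 \<Rightarrow> real^4 \<Rightarrow> real^4" where
  "hess \<zeta> p v = tproj p (vector_derivative
      (\<lambda>t. tproj (geod p v t) (vector_derivative (\<lambda>s. \<zeta> (geod p v s)) (at t))) (at 0))"

definition tangent_onb :: "real^4 \<Rightarrow> (nat \<Rightarrow> real^4) \<Rightarrow> bool" where
  "tangent_onb p e \<longleftrightarrow> (\<forall>i<3. e i \<bullet> p = 0) \<and>
      (\<forall>i<3. \<forall>j<3. e i \<bullet> e j = (if i = j then 1 else 0))"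

definition rough_laplacian :: "(real^4 \<Rightarrow> real^4) \<Rightarrow> real^4 \<Rightarrow> real^4" where
  "rough_laplacian \<zeta> p = (let e = SOME e. tangent_onb p e in \<Sum>i<3. hess \<zeta> p (e i))"

definition nabla_norm2 :: "(real^4 \<Rightarrow> real^4) \<Rightarrow> real^4 \<Rightarrow> real" where
  "nabla_norm2 \<zeta> p = (let e = SOME e. tangent_onb p e in \<Sum>i<3. (norm (cov \<zeta> p (e i)))\<^sup>2)"

definition harmonic_unit_field :: "(real^4 \<Rightarrow> real^4) \<Rightarrow> bool" where
  "harmonic_unit_field \<zeta> \<longleftrightarrow>
     (\<forall>p\<in>S3. rough_laplacian \<zeta> p + nabla_norm2 \<zeta> p *\<^sub>R \<zeta> p = 0)"

definition integral_curve :: "(real^4 \<Rightarrow> real^4) \<Rightarrow> (real \<Rightarrow> real^4) \<Rightarrow> bool" where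
  "integral_curve \<zeta> c \<longleftrightarrow>
     (\<forall>t. c t \<in> S3 \<and> (c has_vector_derivative \<zeta> (c t)) (at t))"

definition great_circle :: "(real^4) set \<Rightarrow> bool" where
  "great_circle C \<longleftrightarrow> (\<exists>W. subspace W \<and> dim W = 2 \<and> C = W \<inter> S3)"

definition hopf_field :: "(real^4 \<Rightarrow> real^4) \<Rightarrow> bool" where
  "hopf_field \<zeta> \<longleftrightarrow> (\<exists>J :: real^4^4. orthogonal_matrix J \<and> J ** J = - mat 1 \<and>
      (\<forall>p\<in>S3. \<zeta> p = J *v p))"

end

theory Submission
  imports Defs
begin

text \<open>Extend \<open>\<zeta>\<close> to \<open>G x = \<bar>x\<bar> \<zeta> (x / \<bar>x\<bar>)\<close> off the origin of \<open>\<real>\<^sup>4\<close>. Great circles as integral curves mean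
  \<open>DG(G x) = - x\<close>, and differentiating this relation together with \<open>x \<bullet> G x = 0\<close>, \<open>\<bar>G x\<bar> = \<bar>x\<bar>\<close> and \<open>DG(x) = G x\<close>
  determines all second derivatives of \<open>G\<close> except the part in which both arguments and the value are orthogonal to
  \<open>x\<close> and \<open>G x\<close>. Harmonicity says that \<open>\<Delta>G\<close> lies in the plane of \<open>x\<close> and \<open>G x\<close>, so
  \<open>\<bar>x\<bar>\<^sup>2 \<Delta>G = - 2 h x + (4 - \<bar>DG\<bar>\<^sup>2) G\<close> with \<open>h = tr DG\<close>. Taking the divergence gives
  \<open>\<Delta>h = 4 r\<^sup>2 h\<close> on the sphere, where \<open>r\<close> is the size of the trace-free symmetric part of \<open>\<nabla>\<zeta>\<close> on the plane orthogonal to \<open>\<zeta>\<close>,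
  and the maximum principle forces \<open>h = 0\<close>. Then \<open>\<bar>DG\<bar>\<^sup>2 = 4 + 4 r\<^sup>2\<close> and Bochner's formula gives
  \<open>\<Delta>(r\<^sup>2) \<ge> 4 r\<^sup>2\<close>, so \<open>r = 0\<close> by the maximum principle again; equality in Bochner's formula
  then shows \<open>D\<^sup>2G = 0\<close>, that is, \<open>G\<close> is linear.\<close>

section \<open>Calculus\<close>

lemma has_derivative_line:
  fixes g :: "'a::real_normed_vector \<Rightarrow> 'b::real_normed_vector"
  assumes "(g has_derivative g') (at (x + t *\<^sub>R u))"
  shows "((\<lambda>s. g (x + s *\<^sub>R u)) has_vector_derivative g' u) (at t)"
proof -
  have "((\<lambda>s. x + s *\<^sub>R u) has_vector_derivative u) (at t)"
    by (auto intro!: derivative_eq_intros)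
  from vector_derivative_diff_chain_within[OF this has_derivative_at_withinI[OF assms]]
  show ?thesis by (simp add: o_def)
qed

text \<open>The mixed second difference is an increment along \<open>u\<close> of a first difference
  along \<open>v\<close>. The mean value theorem in \<open>a\<close> and then in \<open>b\<close>
  turns it into \<open>s * s\<close> times a second derivative.\<close>

lemma second_difference_mvt:
  fixes g :: "'a::real_normed_vector \<Rightarrow> real"
  assumes s: "0 < s"
    and D: "\<And>a b. a \<in> {0..s} \<Longrightarrow> b \<in> {0..s} \<Longrightarrow>
      (g has_derivative g' (x + a *\<^sub>R u + b *\<^sub>R v)) (at (x + a *\<^sub>R u + b *\<^sub>R v))"
    and D2: "\<And>a b. a \<in> {0..s} \<Longrightarrow> b \<in> {0..s} \<Longrightarrow>
      ((\<lambda>y. g' y u) has_derivative g2 (x + a *\<^sub>R u + b *\<^sub>R v)) (at (x + a *\<^sub>R u + b *\<^sub>R v))"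
  obtains a b where "a \<in> {0..s}" "b \<in> {0..s}"
    "g (x + s *\<^sub>R u + s *\<^sub>R v) - g (x + s *\<^sub>R u) - g (x + s *\<^sub>R v) + g x
      = s * s * g2 (x + a *\<^sub>R u + b *\<^sub>R v) v"
proof -
  have "\<exists>a>0. a < s \<and> (g (x + s *\<^sub>R u + s *\<^sub>R v) - g (x + s *\<^sub>R u)) - (g (x + 0 *\<^sub>R u + s *\<^sub>R v) - g (x + 0 *\<^sub>R u))
     = (s - 0) * (g' (x + a *\<^sub>R u + s *\<^sub>R v) u - g' (x + a *\<^sub>R u) u)"
  proof (rule MVT2[OF s])
    fix a assume a: "0 \<le> a" "a \<le> s"
    have 1: "((\<lambda>a. g (x + s *\<^sub>R v + a *\<^sub>R u)) has_vector_derivative g' (x + a *\<^sub>R u + s *\<^sub>R v) u) (at a)"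
      using D[of a s] a s by (intro has_derivative_line) (simp add: algebra_simps)
    have 2: "((\<lambda>a. g (x + a *\<^sub>R u)) has_vector_derivative g' (x + a *\<^sub>R u) u) (at a)"
      using D[of a 0] a s by (intro has_derivative_line) simp
    show "((\<lambda>a. g (x + a *\<^sub>R u + s *\<^sub>R v) - g (x + a *\<^sub>R u)) has_real_derivative
      g' (x + a *\<^sub>R u + s *\<^sub>R v) u - g' (x + a *\<^sub>R u) u) (at a)"
      using has_vector_derivative_diff[OF 1 2]
      by (simp add: has_real_derivative_iff_has_vector_derivative algebra_simps)
  qed
  then obtain a where a: "0 < a" "a < s" and ae: "(g (x + s *\<^sub>R u + s *\<^sub>R v) - g (x + s *\<^sub>R u)) - (g (x + s *\<^sub>R v) - g x)
     = s * (g' (x + a *\<^sub>R u + s *\<^sub>R v) u - g' (x + a *\<^sub>R u) u)"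
    by auto
  have "\<exists>b>0. b < s \<and> g' (x + a *\<^sub>R u + s *\<^sub>R v) u - g' (x + a *\<^sub>R u + 0 *\<^sub>R v) u
     = (s - 0) * g2 (x + a *\<^sub>R u + b *\<^sub>R v) v"
  proof (rule MVT2[OF s])
    fix b assume b: "0 \<le> b" "b \<le> s"
    show "((\<lambda>b. g' (x + a *\<^sub>R u + b *\<^sub>R v) u) has_real_derivative g2 (x + a *\<^sub>R u + b *\<^sub>R v) v) (at b)"
      unfolding has_real_derivative_iff_has_vector_derivative
      using D2[of a b] a b s by (intro has_derivative_line) auto
  qed
  then obtain b where b: "0 < b" "b < s" and be: "g' (x + a *\<^sub>R u + s *\<^sub>R v) u - g' (x + a *\<^sub>R u) u
     = s * g2 (x + a *\<^sub>R u + b *\<^sub>R v) v"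
    by auto
  show thesis
  proof (rule that[of a b])
    show "g (x + s *\<^sub>R u + s *\<^sub>R v) - g (x + s *\<^sub>R u) - g (x + s *\<^sub>R v) + g x
      = s * s * g2 (x + a *\<^sub>R u + b *\<^sub>R v) v"
      using ae unfolding be by (simp only: mult.assoc)
  qed (use a b in auto)
qed

text \<open>The second difference is symmetric in \<open>u\<close> and \<open>v\<close>, so
  \<open>second_difference_mvt\<close> makes the two mixed derivatives agree at a pair of points
  arbitrarily close to \<open>x\<close>; continuity then excludes a gap at \<open>x\<close>.\<close>

lemma symmetric_second_derivative_real:
  fixes g :: "'a::real_normed_vector \<Rightarrow> real"
  assumes "open S" "x \<in> S"
    and D: "\<And>y. y \<in> S \<Longrightarrow> (g has_derivative g' y) (at y)"
    and Du: "\<And>y. y \<in> S \<Longrightarrow> ((\<lambda>y. g' y u) has_derivative gu y) (at y)"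
    and Dv: "\<And>y. y \<in> S \<Longrightarrow> ((\<lambda>y. g' y v) has_derivative gv y) (at y)"
    and cu: "continuous_on S (\<lambda>y. gu y v)" and cv: "continuous_on S (\<lambda>y. gv y u)"
  shows "gu x v = gv x u"
proof (rule ccontr)
  assume ne: "gu x v \<noteq> gv x u"
  define e where "e = \<bar>gu x v - gv x u\<bar> / 2"
  have e: "e > 0" using ne by (simp add: e_def)
  have c: "isCont (\<lambda>y. gu y v) x" "isCont (\<lambda>y. gv y u) x"
    using cu cv assms(1,2) by (auto simp: continuous_on_eq_continuous_at)
  obtain d1 where d1: "d1 > 0" "\<And>y. dist y x < d1 \<Longrightarrow> \<bar>gu y v - gu x v\<bar> < e"
    using c(1) e unfolding continuous_at_eps_delta dist_real_def by auto
  obtain d2 where d2: "d2 > 0" "\<And>y. dist y x < d2 \<Longrightarrow> \<bar>gv y u - gv x u\<bar> < e"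
    using c(2) e unfolding continuous_at_eps_delta dist_real_def by auto
  obtain d3 where d3: "d3 > 0" "ball x d3 \<subseteq> S"
    using assms(1,2) openE by blast
  define d where "d = min d1 (min d2 d3)"
  \<comment> \<open>Small enough that the whole parallelogram with sides \<open>s\<close> times
    \<open>u\<close> and \<open>v\<close> stays within distance \<open>d\<close> of
    \<open>x\<close>.\<close>
  define s where "s = d / (norm u + norm v + 1)"
  have d: "d > 0" using d1 d2 d3 by (simp add: d_def)
  have np: "norm u + norm v + 1 > 0" by (simp add: add_nonneg_pos)
  have s: "s > 0" using d np by (simp add: s_def)
  have sd: "s * (norm u + norm v) < d"
    using d np by (simp add: s_def field_simps)
  have near: "dist (x + a *\<^sub>R u + b *\<^sub>R v) x < d" if "a \<in> {0..s}" "b \<in> {0..s}" for a b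
  proof -
    have "norm (a *\<^sub>R u + b *\<^sub>R v) \<le> a * norm u + b * norm v"
      using that by (intro norm_triangle_le) auto
    also have "\<dots> \<le> s * norm u + s * norm v"
      using that by (intro add_mono mult_right_mono) auto
    also have "\<dots> < d" using sd by (simp add: algebra_simps)
    finally show ?thesis by (simp add: dist_norm add.assoc)
  qed
  then have inS: "x + a *\<^sub>R u + b *\<^sub>R v \<in> S" if "a \<in> {0..s}" "b \<in> {0..s}" for a b
    using that d3 by (force simp: d_def dist_commute)
  obtain a b where ab: "a \<in> {0..s}" "b \<in> {0..s}" and
    e1: "g (x + s *\<^sub>R u + s *\<^sub>R v) - g (x + s *\<^sub>R u) - g (x + s *\<^sub>R v) + g x
      = s * s * gu (x + a *\<^sub>R u + b *\<^sub>R v) v"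
    by (rule second_difference_mvt[OF s, of g g' x u v gu]) (use D Du inS in auto)
  have inS': "x + b *\<^sub>R v + a *\<^sub>R u \<in> S" if "a \<in> {0..s}" "b \<in> {0..s}" for a b
    using inS[OF that] by (simp add: algebra_simps)
  obtain a' b' where ab': "a' \<in> {0..s}" "b' \<in> {0..s}" and
    e2: "g (x + s *\<^sub>R v + s *\<^sub>R u) - g (x + s *\<^sub>R v) - g (x + s *\<^sub>R u) + g x
      = s * s * gv (x + b' *\<^sub>R v + a' *\<^sub>R u) u"
    by (rule second_difference_mvt[OF s, of g g' x v u gv]) (use D Dv inS' in auto)
  have comm: "x + s *\<^sub>R v + s *\<^sub>R u = x + s *\<^sub>R u + s *\<^sub>R v" by (simp add: algebra_simps)
  have "s * s * gu (x + a *\<^sub>R u + b *\<^sub>R v) v = s * s * gv (x + b' *\<^sub>R v + a' *\<^sub>R u) u"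
    using e1 e2[unfolded comm] by linarith
  then have "gu (x + a *\<^sub>R u + b *\<^sub>R v) v = gv (x + a' *\<^sub>R u + b' *\<^sub>R v) u"
    using s by (simp add: add.commute add.left_commute)
  moreover have "\<bar>gu (x + a *\<^sub>R u + b *\<^sub>R v) v - gu x v\<bar> < e"
    using near[OF ab] by (intro d1) (simp add: d_def)
  moreover have "\<bar>gv (x + a' *\<^sub>R u + b' *\<^sub>R v) u - gv x u\<bar> < e"
    using near[OF ab'] by (intro d2) (simp add: d_def)
  ultimately show False unfolding e_def by (simp add: abs_if split: if_splits)
qed

lemma symmetric_second_derivative:
  fixes g :: "'a::real_normed_vector \<Rightarrow> 'b::euclidean_space"
  assumes "open S" "x \<in> S"
    and D: "\<And>y. y \<in> S \<Longrightarrow> (g has_derivative g' y) (at y)"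
    and Du: "\<And>y. y \<in> S \<Longrightarrow> ((\<lambda>y. g' y u) has_derivative gu y) (at y)"
    and Dv: "\<And>y. y \<in> S \<Longrightarrow> ((\<lambda>y. g' y v) has_derivative gv y) (at y)"
    and cu: "continuous_on S (\<lambda>y. gu y v)" and cv: "continuous_on S (\<lambda>y. gv y u)"
  shows "gu x v = gv x u"
proof (rule euclidean_eqI)
  fix b :: 'b
  show "gu x v \<bullet> b = gv x u \<bullet> b"
  proof (rule symmetric_second_derivative_real[OF assms(1,2), where g = "\<lambda>y. g y \<bullet> b"
        and g' = "\<lambda>y w. g' y w \<bullet> b" and gu = "\<lambda>y w. gu y w \<bullet> b" and gv = "\<lambda>y w. gv y w \<bullet> b"])
  qed (use D Du Dv cu cv in \<open>auto intro!: has_derivative_inner_left continuous_intros\<close>)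
qed

text \<open>If \<open>l\<close> were positive, \<open>f'\<close> would be positive just to the right
  of its zero at 0, and the mean value theorem would give a value above \<open>f 0\<close>.\<close>

lemma second_derivative_nonpos_at_max:
  fixes f :: "real \<Rightarrow> real"
  assumes "\<And>t. \<bar>t\<bar> < d \<Longrightarrow> (f has_real_derivative f' t) (at t)" "0 < d"
    and f2: "(f' has_real_derivative l) (at 0)"
    and mx: "\<And>t. \<bar>t\<bar> < d \<Longrightarrow> f t \<le> f 0"
  shows "f' 0 = 0" "l \<le> 0"
proof -
  show f0: "f' 0 = 0"
    by (rule DERIV_local_max[OF assms(1) assms(2)]) (use assms in auto)
  show "l \<le> 0"
  proof (rule ccontr)
    assume "\<not> l \<le> 0"
    then obtain e where e: "e > 0" "\<And>h. 0 < h \<Longrightarrow> h < e \<Longrightarrow> f' 0 < f' (0 + h)"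
      using DERIV_pos_inc_right[OF f2] by auto
    define h where "h = min e d / 2"
    have h: "0 < h" "h < e" "h < d" using e(1) assms(2) by (auto simp: h_def)
    have "\<exists>z>0. z < h \<and> f h - f 0 = (h - 0) * f' z"
      by (rule MVT2) (use h assms(1) in auto)
    then obtain z where z: "0 < z" "z < h" "f h - f 0 = h * f' z" by auto
    have "f' z > 0" using e(2)[of z] z h f0 by simp
    then have "f h > f 0" using z h by (smt (verit) mult_pos_pos)
    with mx[of h] h show False by simp
  qed
qed

text \<open>Product rule when base point and argument both move, from derivatives known for fixed
  arguments. Expanding the argument in \<open>Basis\<close> reduces it to scalar multiples of
  those.\<close>

lemma has_derivative_linear_family:
  fixes L :: "'a::real_normed_vector \<Rightarrow> 'b::euclidean_space \<Rightarrow> 'c::real_normed_vector"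
  assumes L: "\<And>v. ((\<lambda>y. L y v) has_derivative (\<lambda>u. M u v)) (at x)"
    and lin: "\<forall>\<^sub>F y in nhds x. linear (L y)" and linM: "\<And>u. linear (M u)"
    and X: "(X has_derivative X') (at x)"
  shows "((\<lambda>y. L y (X y)) has_derivative (\<lambda>u. M u (X x) + L x (X' u))) (at x)"
proof -
  have lx: "linear (L x)" using lin eventually_nhds_x_imp_x by blast
  have exp: "K w = (\<Sum>b\<in>Basis. (w \<bullet> b) *\<^sub>R K b)" if "linear K" for K :: "'b \<Rightarrow> 'c" and w
  proof -
    have "K w = K (\<Sum>b\<in>Basis. (w \<bullet> b) *\<^sub>R b)" by (simp add: euclidean_representation)
    also have "\<dots> = (\<Sum>b\<in>Basis. (w \<bullet> b) *\<^sub>R K b)"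
      using that by (simp add: linear_sum linear_scale)
    finally show ?thesis .
  qed
  have "((\<lambda>y. \<Sum>b\<in>Basis. (X y \<bullet> b) *\<^sub>R L y b) has_derivative
     (\<lambda>u. \<Sum>b\<in>Basis. (X x \<bullet> b) *\<^sub>R M u b + (X' u \<bullet> b) *\<^sub>R L x b)) (at x)"
    by (intro has_derivative_sum has_derivative_scaleR has_derivative_inner_left X L)
  also have "(\<lambda>u. \<Sum>b\<in>Basis. (X x \<bullet> b) *\<^sub>R M u b + (X' u \<bullet> b) *\<^sub>R L x b) = (\<lambda>u. M u (X x) + L x (X' u))"
    by (rule ext) (simp add: sum.distrib exp[OF lx, of "X' _"] exp[OF linM, of _ "X x"])
  finally have 1: "((\<lambda>y. \<Sum>b\<in>Basis. (X y \<bullet> b) *\<^sub>R L y b) has_derivative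
     (\<lambda>u. M u (X x) + L x (X' u))) (at x)" .
  have "\<forall>\<^sub>F y in nhds x. (\<Sum>b\<in>Basis. (X y \<bullet> b) *\<^sub>R L y b) = L y (X y)"
    using lin by eventually_elim (simp add: exp[symmetric])
  then have "\<forall>\<^sub>F y in at x. (\<Sum>b\<in>Basis. (X y \<bullet> b) *\<^sub>R L y b) = L y (X y)"
    by (simp add: eventually_at_filter eventually_mono)
  moreover have "(\<Sum>b\<in>Basis. (X x \<bullet> b) *\<^sub>R L x b) = L x (X x)"
    by (rule exp[OF lx, symmetric])
  ultimately show ?thesis
    by (rule has_derivative_transform_eventually[OF 1]) simp
qed

section \<open>Smooth maps and homogeneous extensions\<close>

lemma Ck_on_has_derivative:
  assumes "open S" "Ck_on (Suc k) S f" "x \<in> S"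
  shows "(f has_derivative frechet_derivative f (at x)) (at x)"
  using assms by (auto simp: differentiable_on_eq_differentiable_at frechet_derivative_works[symmetric])

lemma Ck_on_cong:
  assumes "open S" "\<And>x. x \<in> S \<Longrightarrow> f x = g x" "Ck_on k S f"
  shows "Ck_on k S g"
  using assms(2,3)
proof (induction k arbitrary: f g)
  case 0
  then show ?case by (simp cong: continuous_on_cong)
next
  case (Suc k)
  have ev: "(g has_derivative frechet_derivative f (at x)) (at x)" if "x \<in> S" for x
    using has_derivative_transform_within_open[OF Ck_on_has_derivative[OF assms(1) Suc.prems(2) that] assms(1) that]
      Suc.prems(1) by auto
  then have "frechet_derivative f (at x) = frechet_derivative g (at x)" if "x \<in> S" for x
    using that frechet_derivative_at by blast
  moreover have "g differentiable_on S"
    using ev assms(1) by (auto simp: differentiable_on_eq_differentiable_at differentiable_def)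
  ultimately show ?case
    using Suc.IH[of "\<lambda>x. frechet_derivative f (at x) _"] Suc.prems(2) by simp
qed

text \<open>Lets an explicit derivative formula replace \<open>frechet_derivative\<close> in the
  recursion of \<open>Ck_on\<close>; the inductions below use it.\<close>

lemma Ck_on_SucI:
  assumes "open S" and D: "\<And>x. x \<in> S \<Longrightarrow> (f has_derivative f' x) (at x)"
    and "\<And>v. Ck_on k S (\<lambda>x. f' x v)"
  shows "Ck_on (Suc k) S f"
proof -
  have "f' x = frechet_derivative f (at x)" if "x \<in> S" for x
    using D[OF that] frechet_derivative_at by blast
  then have "Ck_on k S (\<lambda>x. frechet_derivative f (at x) v)" for v
    using Ck_on_cong[OF assms(1) _ assms(3)[of v]] by simp
  moreover have "f differentiable_on S"
    using D assms(1) by (auto simp: differentiable_on_eq_differentiable_at differentiable_def)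
  ultimately show ?thesis by simp
qed

lemma Ck_on_Suc_imp: "Ck_on (Suc k) S f \<Longrightarrow> Ck_on k S f"
  by (induction k arbitrary: f) (auto intro: differentiable_imp_continuous_on)

lemma Ck_on_const: "open S \<Longrightarrow> Ck_on k S (\<lambda>x. c)"
proof (induction k arbitrary: c)
  case (Suc k)
  show ?case by (rule Ck_on_SucI[where f' = "\<lambda>x v. 0"]) (use Suc in auto)
qed simp

lemma Ck_on_bounded_linear: "open S \<Longrightarrow> bounded_linear f \<Longrightarrow> Ck_on k S f"
proof (cases k)
  case (Suc n)
  assume "open S" "bounded_linear f"
  then show ?thesis unfolding Suc
    by (intro Ck_on_SucI[where f' = "\<lambda>x. f"]) (auto intro: Ck_on_const bounded_linear_imp_has_derivative)
qed (simp add: linear_continuous_on)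

lemma Ck_on_add:
  "open S \<Longrightarrow> Ck_on k S f \<Longrightarrow> Ck_on k S g \<Longrightarrow> Ck_on k S (\<lambda>x. f x + g x)"
proof (induction k arbitrary: f g)
  case (Suc k)
  show ?case
    by (rule Ck_on_SucI[where f' = "\<lambda>x v. frechet_derivative f (at x) v + frechet_derivative g (at x) v"])
      (use Suc in \<open>auto intro!: has_derivative_add Ck_on_has_derivative[where k = k]\<close>)
qed (simp add: continuous_on_add)

lemma Ck_on_sum:
  "open S \<Longrightarrow> (\<And>i. i \<in> I \<Longrightarrow> Ck_on k S (f i)) \<Longrightarrow> Ck_on k S (\<lambda>x. \<Sum>i\<in>I. f i x)"
  by (induction I rule: infinite_finite_induct) (auto intro: Ck_on_const Ck_on_add)

lemma Ck_on_bilinear: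
  fixes f :: "'a::euclidean_space \<Rightarrow> 'b::euclidean_space"
    and g :: "'a \<Rightarrow> 'c::euclidean_space" and h :: "'b \<Rightarrow> 'c \<Rightarrow> 'd::euclidean_space"
  assumes "open S" "bounded_bilinear h"
  shows "Ck_on k S f \<Longrightarrow> Ck_on k S g \<Longrightarrow> Ck_on k S (\<lambda>x. h (f x) (g x))"
proof (induction k arbitrary: f g)
  case 0
  then show ?case using assms by (auto intro: bounded_bilinear.continuous_on)
next
  case (Suc k)
  note imp = Suc.prems[THEN Ck_on_Suc_imp]
  show ?case
  proof (rule Ck_on_SucI[OF assms(1)])
    show "((\<lambda>x. h (f x) (g x)) has_derivative
      (\<lambda>v. h (f x) (frechet_derivative g (at x) v) + h (frechet_derivative f (at x) v) (g x))) (at x)"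
      if "x \<in> S" for x
      by (rule bounded_bilinear.FDERIV[OF assms(2) Ck_on_has_derivative[OF assms(1) Suc.prems(1) that]
            Ck_on_has_derivative[OF assms(1) Suc.prems(2) that]])
    show "Ck_on k S (\<lambda>x. h (f x) (frechet_derivative g (at x) v) + h (frechet_derivative f (at x) v) (g x))" for v
      using Suc.prems imp by (intro Ck_on_add assms(1) Suc.IH) auto
  qed
qed

lemma Ck_on_compose:
  fixes f :: "'b::euclidean_space \<Rightarrow> 'c::euclidean_space" and g :: "'a::euclidean_space \<Rightarrow> 'b"
  assumes "open S" "open T" "g ` S \<subseteq> T"
  shows "Ck_on k T f \<Longrightarrow> Ck_on k S g \<Longrightarrow> Ck_on k S (\<lambda>x. f (g x))"
proof (induction k arbitrary: f)
  case 0
  then show ?case using assms(3) by (auto intro: continuous_on_compose2)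
next
  case (Suc k)
  \<comment> \<open>The chain rule is written in coordinates because \<open>Ck_on\<close> treats
    derivatives of \<open>f\<close> in fixed directions, whereas the inner derivative is a direction
    that varies with \<open>x\<close>.\<close>
  let ?f' = "\<lambda>x v. \<Sum>b\<in>Basis. (frechet_derivative g (at x) v \<bullet> b) *\<^sub>R frechet_derivative f (at (g x)) b"
  show ?case
  proof (rule Ck_on_SucI[OF assms(1), where f' = ?f'])
    fix x assume x: "x \<in> S"
    have dg: "(g has_derivative frechet_derivative g (at x)) (at x)"
      and df: "(f has_derivative frechet_derivative f (at (g x))) (at (g x))"
      using Ck_on_has_derivative[OF assms(1) Suc.prems(2) x]
        Ck_on_has_derivative[OF assms(2) Suc.prems(1), of "g x"] x assms(3) by auto
    have "frechet_derivative f (at (g x)) w = (\<Sum>b\<in>Basis. (w \<bullet> b) *\<^sub>R frechet_derivative f (at (g x)) b)" for w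
      using linear_sum[OF has_derivative_linear[OF df], of "\<lambda>b. (w \<bullet> b) *\<^sub>R b" Basis]
        linear_scale[OF has_derivative_linear[OF df]] by (simp add: euclidean_representation)
    then have "?f' x = (\<lambda>v. frechet_derivative f (at (g x)) (frechet_derivative g (at x) v))"
      by (intro ext) (rule sym)
    then show "((\<lambda>x. f (g x)) has_derivative ?f' x) (at x)"
      using has_derivative_compose[OF dg df] by simp
  next
    fix v
    have "Ck_on k S (\<lambda>x. frechet_derivative f (at (g x)) b)" for b
      using Suc.IH[of "\<lambda>y. frechet_derivative f (at y) b"] Suc.prems(1) Ck_on_Suc_imp[OF Suc.prems(2)] by simp
    moreover have "Ck_on k S (\<lambda>x. frechet_derivative g (at x) v \<bullet> b)" for b
      using Suc.prems(2) by (intro Ck_on_bilinear[OF assms(1) bounded_bilinear_inner])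
        (auto intro: Ck_on_const assms(1))
    ultimately show "Ck_on k S (\<lambda>x. ?f' x v)"
      by (intro Ck_on_sum Ck_on_bilinear[OF assms(1) bounded_bilinear_scaleR] assms(1))
  qed
qed

text \<open>The derivative is a linear function of \<open>x\<close> times the cube of the function
  itself, so the induction hypothesis and closure under products are enough.\<close>

lemma Ck_on_inverse_norm:
  fixes S :: "'a::euclidean_space set"
  assumes "open S" "0 \<notin> S"
  shows "Ck_on k S (\<lambda>x. inverse (norm x))"
proof (induction k)
  case 0
  then show ?case using assms(2) by (auto intro!: continuous_intros)
next
  case (Suc k)
  let ?n = "\<lambda>x::'a. inverse (norm x)"
  show ?case
  proof (rule Ck_on_SucI[OF assms(1)])
    fix x assume "x \<in> S"
    then have "x \<noteq> 0" using assms(2) by blast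
    then show "(?n has_derivative (\<lambda>v. - ((x \<bullet> v) * (?n x * (?n x * ?n x))))) (at x)"
      by (auto intro!: derivative_eq_intros has_derivative_norm simp: sgn_div_norm inner_commute)
  next
    fix v
    note mult = Ck_on_bilinear[OF assms(1) bounded_bilinear_mult]
    have neg: "(\<lambda>x. - ((x \<bullet> v) * (?n x * (?n x * ?n x)))) = (\<lambda>x. (x \<bullet> - v) * (?n x * (?n x * ?n x)))"
      by simp
    show "Ck_on k S (\<lambda>x. - ((x \<bullet> v) * (?n x * (?n x * ?n x))))"
      unfolding neg
      by (intro mult Suc Ck_on_bounded_linear assms(1) bounded_linear_inner_left)
  qed
qed

text \<open>The radial extension of degree one: its first derivatives are constant along positive
  rays, so facts on the sphere spread to the punctured space. At the origin the factor
  \<open>norm x\<close> gives 0, whatever \<open>f\<close> does.\<close>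

definition hom_ext :: "('a::real_normed_vector \<Rightarrow> 'b::real_normed_vector) \<Rightarrow> 'a \<Rightarrow> 'b" where
  "hom_ext f x = norm x *\<^sub>R f (x /\<^sub>R norm x)"

lemma Ck_on_hom_ext:
  fixes F :: "'a::euclidean_space \<Rightarrow> 'b::euclidean_space"
  assumes U: "open U" "sphere 0 1 \<subseteq> U" "Ck_on k U F" and f: "\<And>p. norm p = 1 \<Longrightarrow> F p = f p"
  shows "Ck_on k (- {0}) (hom_ext f)"
proof -
  let ?S = "- {0} :: 'a set" and ?n = "\<lambda>x::'a. inverse (norm x)"
  have S: "open ?S" by auto
  have n: "Ck_on k ?S ?n" by (rule Ck_on_inverse_norm) auto
  have id: "Ck_on k ?S (\<lambda>x. x)" by (rule Ck_on_bounded_linear) auto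
  note sc = Ck_on_bilinear[OF S bounded_bilinear_scaleR]
  \<comment> \<open>This is \<open>norm x\<close>, written so that only products and the inverse
    norm occur.\<close>
  have m: "Ck_on k ?S (\<lambda>x. (x \<bullet> x) *\<^sub>R ?n x)"
    by (intro sc Ck_on_bilinear[OF S bounded_bilinear_inner] id n)
  have "norm (?n x *\<^sub>R x) = 1" if "x \<noteq> 0" for x :: 'a
    using that by simp
  then have "(\<lambda>x. ?n x *\<^sub>R x) ` ?S \<subseteq> U"
    using U(2) by (intro image_subsetI subsetD[OF U(2)]) (simp add: dist_norm)
  then have "Ck_on k ?S (\<lambda>x. F (?n x *\<^sub>R x))"
    by (rule Ck_on_compose[OF S U(1) _ U(3)]) (intro sc n id)
  with m have "Ck_on k ?S (\<lambda>x. ((x \<bullet> x) *\<^sub>R ?n x) *\<^sub>R F (?n x *\<^sub>R x))"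
    by (rule sc)
  then show ?thesis
    by (rule Ck_on_cong[OF S, rotated])
      (auto simp: hom_ext_def f dot_square_norm power2_eq_square)
qed

section \<open>Global solutions of Lipschitz differential equations\<close>

lemma antiderivative_exists:
  fixes f :: "real \<Rightarrow> 'a::euclidean_space"
  assumes "continuous_on UNIV f"
  shows "\<exists>F. F 0 = 0 \<and> (\<forall>t. (F has_vector_derivative f t) (at t))"
proof (intro exI conjI allI)
  show "(LBINT y=0..ereal 0. f y) = 0"
    by (simp add: zero_ereal_def)
  fix t :: real
  let ?N = "\<bar>t\<bar> + 1"
  have "((\<lambda>u. LBINT y=ereal 0..u. f y) has_vector_derivative f t) (at t within {-?N..?N})"
    by (rule interval_integral_FTC2) (use assms continuous_on_subset in auto)
  moreover have "at t within {-?N..?N} = at t"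
    by (rule at_within_interior) (auto simp: interior_atLeastAtMost_real)
  ultimately show "((\<lambda>u. LBINT y=0..ereal u. f y) has_vector_derivative f t) (at t)"
    by (simp add: zero_ereal_def)
qed

text \<open>Mean value inequality against \<open>M / K * exp (K * t)\<close>. The gained factor
  \<open>1 / K\<close> is what makes Picard iteration a contraction for large
  \<open>K\<close>.\<close>

lemma exp_bound_antiderivative_nonneg:
  fixes F :: "real \<Rightarrow> 'a::real_normed_vector"
  assumes F: "F 0 = 0" "\<And>t. (F has_vector_derivative f t) (at t)"
    and b: "\<And>t. t > 0 \<Longrightarrow> norm (f t) \<le> M * exp (K * t)" and K: "K > 0" and M: "M \<ge> 0" and t: "t \<ge> 0"
  shows "norm (F t) \<le> M / K * exp (K * t)"
proof (cases "t = 0")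
  case True
  then show ?thesis using F K M by simp
next
  case False
  then have "0 < t" using t by simp
  then have "norm (F t - F 0) \<le> M / K * exp (K * t) - M / K * exp (K * 0)"
  proof (rule differentiable_bound_general[where \<phi>' = "\<lambda>t. M * exp (K * t)"])
    show "continuous_on {0..t} F"
      using F(2) by (meson continuous_at_imp_continuous_on has_vector_derivative_continuous)
    show "((\<lambda>t. M / K * exp (K * t)) has_vector_derivative M * exp (K * x)) (at x)" for x
      unfolding has_real_derivative_iff_has_vector_derivative[symmetric]
      using K by (auto intro!: derivative_eq_intros)
  qed (use F b K in \<open>auto intro!: continuous_intros\<close>)
  moreover have "0 \<le> M / K" using K M by simp
  ultimately show ?thesis using F(1) by simp
qed

lemma exp_bound_antiderivative:
  fixes F :: "real \<Rightarrow> 'a::real_normed_vector"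
  assumes F: "F 0 = 0" "\<And>t. (F has_vector_derivative f t) (at t)"
    and b: "\<And>t. norm (f t) \<le> M * exp (K * \<bar>t\<bar>)" and K: "K > 0" and M: "M \<ge> 0"
  shows "norm (F t) \<le> M / K * exp (K * \<bar>t\<bar>)"
proof (cases "t \<ge> 0")
  case True
  have "norm (F t) \<le> M / K * exp (K * t)"
    by (rule exp_bound_antiderivative_nonneg[OF F _ K M True]) (use b[of t] b in \<open>metis abs_of_pos\<close>)
  then show ?thesis using True by simp
next
  case False
  have "norm (F (- (-t))) \<le> M / K * exp (K * -t)"
  proof (rule exp_bound_antiderivative_nonneg[where F = "\<lambda>t. F (-t)" and f = "\<lambda>t. - f (-t)"])
    show "((\<lambda>t. F (-t)) has_vector_derivative - f (-s)) (at s)" for s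
    proof -
      have "(uminus has_vector_derivative -1) (at s)"
        by (auto intro!: derivative_eq_intros)
      from vector_diff_chain_at[OF this F(2)] show ?thesis by (simp add: o_def)
    qed
    show "norm (- f (- s)) \<le> M * exp (K * s)" if "s > 0" for s
      using b[of "-s"] that by simp
  qed (use F K M False in auto)
  then show ?thesis using False by simp
qed

text \<open>Picard iteration in the weighted norm \<open>sup\<^sub>t exp (- K \<bar>t\<bar>) * norm (c t)\<close>, for which it is
  a contraction on the whole line as soon as \<open>K\<close> exceeds the Lipschitz constant.\<close>

lemma global_ode_solution:
  fixes G :: "'a::euclidean_space \<Rightarrow> 'a"
  assumes lip: "\<And>x y. norm (G x - G y) \<le> L * norm (x - y)" and L: "L \<ge> 0"
  obtains c where "c 0 = x0" "\<And>t. (c has_vector_derivative G (c t)) (at t)"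
proof -
  define K where "K = L + 1"
  have K: "K > 0" "L / K < 1" using L by (auto simp: K_def)
  have contG: "continuous_on UNIV G"
    using lipschitz_on_continuous_on[of L UNIV G] lip L
    by (auto simp: lipschitz_on_def dist_norm)
  \<comment> \<open>The iteration runs in the Banach space of bounded continuous functions
    \<open>y\<close>; \<open>X y\<close> is the possibly unbounded curve obtained by undoing the
    weight.\<close>
  define X where "X y t = exp (K * \<bar>t\<bar>) *\<^sub>R apply_bcontfun y t" for y :: "real \<Rightarrow>\<^sub>C 'a" and t
  have contX: "continuous_on UNIV (\<lambda>t. G (X y t))" for y
    unfolding X_def by (intro continuous_on_compose2[OF contG] continuous_intros) auto
  define F where "F y = (SOME F. F 0 = 0 \<and> (\<forall>t. (F has_vector_derivative G (X y t)) (at t)))" for y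
  have F: "F y 0 = 0" "(F y has_vector_derivative G (X y t)) (at t)" for y t
    using someI_ex[OF antiderivative_exists[OF contX]] unfolding F_def by blast+
  \<comment> \<open>The Picard operator, \<open>x0\<close> plus the integral of \<open>G\<close>
    along the curve, with the weight put back.\<close>
  define T where "T y = (\<lambda>t. exp (- (K * \<bar>t\<bar>)) *\<^sub>R (x0 + F y t))" for y
  have TB: "T y \<in> bcontfun" for y
  proof (rule bcontfun_normI)
    have "continuous_on UNIV (F y)"
      using F(2) by (meson continuous_at_imp_continuous_on has_vector_derivative_continuous)
    then show "continuous_on UNIV (T y)"
      unfolding T_def by (intro continuous_intros) auto
    define M where "M = norm (G 0) + L * norm y"
    have M: "M \<ge> 0" using L by (simp add: M_def)
    have "norm (G (X y t)) \<le> M * exp (K * \<bar>t\<bar>)" for t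
    proof -
      have "norm (G (X y t)) \<le> norm (G 0) + norm (G (X y t) - G 0)"
        by norm
      also have "\<dots> \<le> norm (G 0) + L * norm (X y t)" using lip[of "X y t" 0] by simp
      also have "norm (X y t) \<le> norm y * exp (K * \<bar>t\<bar>)"
        by (simp add: X_def norm_bounded mult.commute)
      also have "norm (G 0) + L * (norm y * exp (K * \<bar>t\<bar>)) \<le> M * exp (K * \<bar>t\<bar>)"
      proof -
        have "norm (G 0) * 1 \<le> norm (G 0) * exp (K * \<bar>t\<bar>)"
          using K by (intro mult_left_mono) auto
        then show ?thesis by (simp add: M_def algebra_simps)
      qed
      finally show ?thesis using L by (simp add: mult_left_mono)
    qed
    then have FM: "norm (F y t) \<le> M / K * exp (K * \<bar>t\<bar>)" for t
      using exp_bound_antiderivative[OF F] K M by blast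
    show "norm (T y t) \<le> norm x0 + M / K" for t
    proof -
      have "norm (T y t) \<le> exp (- (K * \<bar>t\<bar>)) * (norm x0 + norm (F y t))"
        by (simp add: T_def norm_triangle_ineq)
      also have "\<dots> \<le> exp (- (K * \<bar>t\<bar>)) * (norm x0 + M / K * exp (K * \<bar>t\<bar>))"
        using FM by (intro mult_left_mono add_left_mono) auto
      also have "\<dots> = exp (- (K * \<bar>t\<bar>)) * norm x0 + M / K"
        by (simp add: algebra_simps exp_minus)
      also have "\<dots> \<le> 1 * norm x0 + M / K"
        using K by (intro add_right_mono mult_right_mono) auto
      finally show ?thesis by simp
    qed
  qed
  define TT where "TT y = Bcontfun (T y)" for y
  have TT: "apply_bcontfun (TT y) = T y" for y
    unfolding TT_def by (rule Bcontfun_inverse[OF TB])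
  have "dist (TT y) (TT z) \<le> L / K * dist y z" for y z
  proof (rule dist_bound)
    fix t
    have "norm (F y t - F z t) \<le> (L * dist y z) / K * exp (K * \<bar>t\<bar>)"
    proof (rule exp_bound_antiderivative[where F = "\<lambda>t. F y t - F z t" and f = "\<lambda>t. G (X y t) - G (X z t)"])
      show "norm (G (X y t) - G (X z t)) \<le> L * dist y z * exp (K * \<bar>t\<bar>)" for t
      proof -
        have "norm (X y t - X z t) = exp (K * \<bar>t\<bar>) * dist (y t) (z t)"
          by (simp add: X_def dist_norm flip: scaleR_diff_right)
        also have "\<dots> \<le> exp (K * \<bar>t\<bar>) * dist y z"
          by (simp add: dist_bounded)
        finally have "L * norm (X y t - X z t) \<le> L * (exp (K * \<bar>t\<bar>) * dist y z)"
          using L by (rule mult_left_mono)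
        then show ?thesis using lip[of "X y t" "X z t"] by (simp add: mult_ac)
      qed
    qed (use F K L in \<open>auto intro!: has_vector_derivative_diff\<close>)
    then have "exp (- (K * \<bar>t\<bar>)) * norm (F y t - F z t) \<le> exp (- (K * \<bar>t\<bar>)) * ((L * dist y z) / K * exp (K * \<bar>t\<bar>))"
      by (rule mult_left_mono) simp
    also have "\<dots> = L / K * dist y z" by (simp add: exp_minus)
    also have "exp (- (K * \<bar>t\<bar>)) * norm (F y t - F z t) = dist (TT y t) (TT z t)"
      by (simp add: TT T_def dist_norm flip: scaleR_diff_right)
    finally show "dist (TT y t) (TT z t) \<le> L / K * dist y z" .
  qed
  then have "\<exists>!y. TT y = y"
    using K L by (intro banach_fix_type[of "L / K"]) auto
  then obtain y where y: "TT y = y" by blast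
  have "X y t = x0 + F y t" for t
  proof -
    have "X y t = exp (K * \<bar>t\<bar>) *\<^sub>R TT y t" by (simp add: y X_def)
    then show ?thesis by (simp add: TT T_def exp_minus)
  qed
  then have X: "X y = (\<lambda>t. x0 + F y t)" by (rule ext)
  show thesis
  proof (rule that[of "X y"])
    show "X y 0 = x0" by (simp add: X F)
    show "(X y has_vector_derivative G (X y t)) (at t)" for t
      using has_vector_derivative_add[OF has_vector_derivative_const F(2)[of y t], of x0] X by simp
  qed
qed

section \<open>Orthonormal frames and maxima of homogeneous functions\<close>

definition onb4 :: "real^4 \<Rightarrow> real^4 \<Rightarrow> real^4 \<Rightarrow> real^4 \<Rightarrow> bool" where
  "onb4 e f g h \<longleftrightarrow> e \<bullet> e = 1 \<and> f \<bullet> f = 1 \<and> g \<bullet> g = 1 \<and> h \<bullet> h = 1 \<and>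
     e \<bullet> f = 0 \<and> e \<bullet> g = 0 \<and> e \<bullet> h = 0 \<and> f \<bullet> g = 0 \<and> f \<bullet> h = 0 \<and> g \<bullet> h = 0"

lemma onb4_expand:
  assumes "onb4 e f g h"
  shows "x = (x \<bullet> e) *\<^sub>R e + (x \<bullet> f) *\<^sub>R f + (x \<bullet> g) *\<^sub>R g + (x \<bullet> h) *\<^sub>R h"
proof -
  let ?B = "{e, f, g, h}"
  note o = assms[unfolded onb4_def]
  have n0: "e \<noteq> 0" "f \<noteq> 0" "g \<noteq> 0" "h \<noteq> 0"
    using o by auto
  have d: "e \<noteq> f" "e \<noteq> g" "e \<noteq> h" "f \<noteq> g" "f \<noteq> h" "g \<noteq> h"
    using o by auto
  have po: "pairwise orthogonal ?B"
    using o by (auto simp: pairwise_def orthogonal_def inner_commute)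
  have "independent ?B"
    using po n0 by (intro pairwise_orthogonal_independent) auto
  moreover have c4: "card ?B = 4" using d by simp
  ultimately have "x \<in> span ?B"
    using card_ge_dim_independent[of ?B UNIV] by auto
  then have "(\<Sum>b\<in>?B. (x \<bullet> b) *\<^sub>R b) = x"
    using po o by (intro orthonormal_basis_expand) (auto simp: norm_eq_1)
  then show ?thesis using d by (simp add: add.assoc)
qed

text \<open>Basis independence of the trace: expand one slot in the frame and collect the other over
  \<open>Basis\<close>. Later traces are thereby computed in a frame containing \<open>p\<close> and
  \<open>G p\<close>.\<close>

lemma trace_onb4:
  fixes b :: "real^4 \<Rightarrow> real^4 \<Rightarrow> 'b::real_vector"
  assumes o: "onb4 e f g h" and l1: "\<And>v. linear (\<lambda>u. b u v)" and l2: "\<And>u. linear (b u)"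
  shows "(\<Sum>i\<in>Basis. b i i) = b e e + b f f + b g g + b h h"
proof -
  have ex1: "b x v = (\<Sum>i\<in>Basis. (x \<bullet> i) *\<^sub>R b i v)" for x v
    using linear_sum[OF l1, of "\<lambda>i. (x \<bullet> i) *\<^sub>R i" Basis v] linear_scale[OF l1]
    by (simp add: euclidean_representation)
  have ex2: "b i i = (i \<bullet> e) *\<^sub>R b i e + (i \<bullet> f) *\<^sub>R b i f + (i \<bullet> g) *\<^sub>R b i g + (i \<bullet> h) *\<^sub>R b i h" for i
    using arg_cong[OF onb4_expand[OF o, of i], of "b i"] linear_add[OF l2, of i] linear_scale[OF l2, of i]
    by simp
  have "(\<Sum>i\<in>Basis. b i i) = (\<Sum>i\<in>Basis. (e \<bullet> i) *\<^sub>R b i e) + (\<Sum>i\<in>Basis. (f \<bullet> i) *\<^sub>R b i f)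
     + (\<Sum>i\<in>Basis. (g \<bullet> i) *\<^sub>R b i g) + (\<Sum>i\<in>Basis. (h \<bullet> i) *\<^sub>R b i h)"
    by (subst sum.cong[OF refl ex2]) (simp_all add: sum.distrib inner_commute)
  then show ?thesis
    by (simp only: ex1[symmetric])
qed

lemma extend_onb4:
  fixes p q :: "real^4"
  assumes "p \<bullet> p = 1" "q \<bullet> q = 1" "p \<bullet> q = 0"
  obtains g h where "onb4 p q g h"
proof -
  have ne: "p \<noteq> q" "p \<noteq> 0" "q \<noteq> 0" using assms by auto
  have ind: "independent {p, q}"
    using assms ne by (intro pairwise_orthogonal_independent) (auto simp: pairwise_def orthogonal_def inner_commute)
  let ?S = "{x. \<forall>y\<in>span {p,q}. orthogonal y x}"
  have "dim ?S + dim (span {p,q}) = dim (UNIV :: (real^4) set)"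
    using dim_subspace_orthogonal_to_vectors[of "span {p,q}" UNIV] by simp
  moreover have "dim (span {p,q}) = 2"
    using ind ne by (simp add: dim_eq_card_independent)
  ultimately have d2: "dim ?S = 2" by simp
  obtain B where B: "B \<subseteq> ?S" "pairwise orthogonal B" "\<And>x. x \<in> B \<Longrightarrow> norm x = 1" "card B = dim ?S"
    by (rule orthonormal_basis_subspace[OF subspace_orthogonal_to_vectors[of "span {p,q}"]]) blast
  with d2 obtain g h where gh: "B = {g, h}" "g \<noteq> h"
    by (auto simp: card_2_iff)
  have "g \<in> ?S" "h \<in> ?S" using B gh by auto
  moreover have "p \<in> span {p,q}" "q \<in> span {p,q}" by (simp_all add: span_base)
  moreover have "orthogonal g h" using B(2) gh by (auto simp: pairwise_def)
  moreover have "norm g = 1" "norm h = 1" using B(3) gh by auto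
  ultimately have "onb4 p q g h"
    using assms by (auto simp: onb4_def orthogonal_def norm_eq_1 inner_commute)
  then show thesis by (rule that)
qed

text \<open>Degree-zero homogeneity turns a maximum on the sphere into one on the punctured space,
  so the one-variable test applies along straight lines in every direction \<open>u\<close>, tangent
  or not.\<close>

lemma max_on_sphere_derivatives:
  fixes q :: "'a::euclidean_space \<Rightarrow> real"
  assumes q: "\<And>y. y \<noteq> 0 \<Longrightarrow> (q has_derivative q' y) (at y)"
    and q': "((\<lambda>y. q' y u) has_derivative (\<lambda>w. q'' w)) (at p)"
    and hom: "\<And>y s. y \<noteq> 0 \<Longrightarrow> s > 0 \<Longrightarrow> q (s *\<^sub>R y) = q y"
    and p: "norm p = 1" and mx: "\<And>y. norm y = 1 \<Longrightarrow> q y \<le> q p"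
  shows "q' p u = 0" "q'' u \<le> 0"
proof -
  \<comment> \<open>For parameters below this bound the line through \<open>p\<close> along
    \<open>u\<close> misses the origin.\<close>
  define d where "d = 1 / (norm u + 1)"
  have d: "d > 0" by (simp add: d_def add_nonneg_pos)
  have nz: "p + t *\<^sub>R u \<noteq> 0" if "\<bar>t\<bar> < d" for t
  proof
    assume "p + t *\<^sub>R u = 0"
    then have "norm p = \<bar>t\<bar> * norm u" by (metis add_eq_0_iff norm_minus_cancel norm_scaleR)
    also have "\<dots> \<le> d * norm u" using that by (intro mult_right_mono) auto
    also have "\<dots> < 1" by (simp add: d_def divide_less_eq add_nonneg_pos)
    finally show False using p by simp
  qed
  have "((\<lambda>t. q (p + t *\<^sub>R u)) has_real_derivative q' (p + t *\<^sub>R u) u) (at t)" if "\<bar>t\<bar> < d" for t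
    unfolding has_real_derivative_iff_has_vector_derivative
    by (intro has_derivative_line q nz that)
  moreover have "((\<lambda>t. q' (p + t *\<^sub>R u) u) has_real_derivative q'' u) (at 0)"
    unfolding has_real_derivative_iff_has_vector_derivative
    using q' by (intro has_derivative_line[where g = "\<lambda>y. q' y u"]) simp
  moreover have "q (p + t *\<^sub>R u) \<le> q (p + 0 *\<^sub>R u)" if "\<bar>t\<bar> < d" for t
    using hom[OF nz[OF that], of "inverse (norm (p + t *\<^sub>R u))"] nz[OF that]
      mx[of "inverse (norm (p + t *\<^sub>R u)) *\<^sub>R (p + t *\<^sub>R u)"] by simp
  ultimately show "q' p u = 0" "q'' u \<le> 0"
    using second_derivative_nonpos_at_max[of d "\<lambda>t. q (p + t *\<^sub>R u)" "\<lambda>t. q' (p + t *\<^sub>R u) u"] d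
    by simp_all
qed

section \<open>Degree-one extensions of unit fields\<close>

text \<open>The form in which identities valid off the origin are differentiated in what
  follows.\<close>

lemma derivatives_eq_off_zero:
  fixes f :: "'a::{real_normed_vector} \<Rightarrow> 'b::real_normed_vector"
  assumes "y \<noteq> 0" "(f has_derivative f') (at y)" "(g has_derivative g') (at y)"
    and "\<And>z. z \<noteq> 0 \<Longrightarrow> f z = g z"
  shows "f' u = g' u"
proof -
  have "(g has_derivative f') (at y)"
    by (rule has_derivative_transform_within_open[OF assms(2), of "- {0}"]) (use assms in auto)
  then show ?thesis using has_derivative_unique[OF _ assms(3)] by blast
qed

text \<open>\<open>D\<close>, \<open>B\<close>, \<open>C\<close> stand for the first three derivatives of \<open>G\<close>, the direction of the latest
  differentiation coming first: \<open>B y u v\<close> is the derivative in direction \<open>u\<close> of \<open>\<lambda>y. D y v\<close>.\<close>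

locale unit_field_ext =
  fixes G :: "real^4 \<Rightarrow> real^4"
    and D :: "real^4 \<Rightarrow> real^4 \<Rightarrow> real^4"
    and B :: "real^4 \<Rightarrow> real^4 \<Rightarrow> real^4 \<Rightarrow> real^4"
    and C :: "real^4 \<Rightarrow> real^4 \<Rightarrow> real^4 \<Rightarrow> real^4 \<Rightarrow> real^4"
  assumes G_deriv: "y \<noteq> 0 \<Longrightarrow> (G has_derivative D y) (at y)"
    and D_deriv: "y \<noteq> 0 \<Longrightarrow> ((\<lambda>y. D y v) has_derivative (\<lambda>u. B y u v)) (at y)"
    and B_deriv: "y \<noteq> 0 \<Longrightarrow> ((\<lambda>y. B y u v) has_derivative (\<lambda>w. C y w u v)) (at y)"
    and B_sym: "y \<noteq> 0 \<Longrightarrow> B y u v = B y v u"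
    and C_sym: "y \<noteq> 0 \<Longrightarrow> C y w u v = C y u w v"
    and G_hom: "y \<noteq> 0 \<Longrightarrow> s > 0 \<Longrightarrow> G (s *\<^sub>R y) = s *\<^sub>R G y"
    and G_orth: "y \<noteq> 0 \<Longrightarrow> y \<bullet> G y = 0"
    and G_norm: "y \<noteq> 0 \<Longrightarrow> G y \<bullet> G y = y \<bullet> y"
begin

section \<open>Multilinearity, and identities forced by homogeneity, tangency and unit
  length\<close>

lemma linear_D: "y \<noteq> 0 \<Longrightarrow> linear (D y)"
  using G_deriv has_derivative_linear by blast

lemma linear_B1: "y \<noteq> 0 \<Longrightarrow> linear (\<lambda>u. B y u v)"
  using D_deriv has_derivative_linear by blast

lemma linear_B2: "y \<noteq> 0 \<Longrightarrow> linear (B y u)"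
  using linear_B1[of y u] ext[of "B y u" "\<lambda>v. B y v u", OF B_sym] by simp

lemma linear_C1: "y \<noteq> 0 \<Longrightarrow> linear (\<lambda>w. C y w u v)"
  using B_deriv has_derivative_linear by blast

lemma C_sym': "y \<noteq> 0 \<Longrightarrow> C y w u v = C y w v u"
  by (rule derivatives_eq_off_zero[OF _ B_deriv B_deriv B_sym]) auto

lemma linear_C2: "y \<noteq> 0 \<Longrightarrow> linear (\<lambda>u. C y w u v)"
  using linear_C1[of y w v] ext[of "\<lambda>u. C y w u v" "\<lambda>u. C y u w v", OF C_sym] by simp

lemma linear_C3: "y \<noteq> 0 \<Longrightarrow> linear (C y w u)"
  using linear_C2[of y w u] ext[of "C y w u" "\<lambda>v. C y w v u", OF C_sym'] by simp

lemmas lin_simps =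
  linear_add[OF linear_D] linear_scale[OF linear_D] linear_neg[OF linear_D] linear_diff[OF linear_D]
  linear_add[OF linear_B1] linear_scale[OF linear_B1] linear_neg[OF linear_B1]
  linear_add[OF linear_B2] linear_scale[OF linear_B2] linear_neg[OF linear_B2]
  linear_add[OF linear_C1] linear_scale[OF linear_C1]
  linear_add[OF linear_C2] linear_scale[OF linear_C2]
  linear_add[OF linear_C3] linear_scale[OF linear_C3]

lemma ev_off_zero: "(y::real^4) \<noteq> 0 \<Longrightarrow> (\<And>z. z \<noteq> 0 \<Longrightarrow> P z) \<Longrightarrow> \<forall>\<^sub>F z in nhds y. P z"
  unfolding eventually_nhds by (intro exI[of _ "- {0}"]) auto

lemma D_moving:
  assumes "y \<noteq> 0" "(X has_derivative X') (at y)"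
  shows "((\<lambda>y. D y (X y)) has_derivative (\<lambda>u. B y u (X y) + D y (X' u))) (at y)"
  by (intro has_derivative_linear_family D_deriv ev_off_zero linear_D linear_B2 assms)

lemma B_moving:
  assumes "y \<noteq> 0" "(X has_derivative X') (at y)"
  shows "((\<lambda>y. B y v (X y)) has_derivative (\<lambda>w. C y w v (X y) + B y v (X' w))) (at y)"
  by (intro has_derivative_linear_family B_deriv ev_off_zero linear_B2 linear_C3 assms)

text \<open>Euler's relation: differentiate \<open>G (s *\<^sub>R y) = s *\<^sub>R G y\<close> in
  \<open>s\<close> at 1.\<close>

lemma D_self: assumes "y \<noteq> 0" shows "D y y = G y"
proof -
  have "((\<lambda>s. G (0 + s *\<^sub>R y)) has_vector_derivative D y y) (at 1)"
    by (rule has_derivative_line) (use G_deriv[OF assms] in simp)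
  then have "((\<lambda>s. s *\<^sub>R G y) has_vector_derivative D y y) (at 1)"
    by (rule has_vector_derivative_transform_within_open[of _ _ _ "{0<..}"])
      (use G_hom[OF assms] in auto)
  moreover have "((\<lambda>s. s *\<^sub>R G y) has_vector_derivative G y) (at 1)"
    by (auto intro!: derivative_eq_intros)
  ultimately show ?thesis by (metis vector_derivative_at)
qed

lemma B_self: assumes "y \<noteq> 0" shows "B y u y = 0" "B y y u = 0"
proof -
  have "B y u y + D y u = D y u"
    by (rule derivatives_eq_off_zero[OF assms D_moving[OF assms has_derivative_ident] G_deriv[OF assms] D_self])
  then show "B y u y = 0" "B y y u = 0" using B_sym[OF assms] by auto
qed

lemma G_D: assumes "y \<noteq> 0" shows "y \<bullet> D y v = - (v \<bullet> G y)" "G y \<bullet> D y v = y \<bullet> v"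
proof -
  have "y \<bullet> D y v + v \<bullet> G y = 0"
    by (rule derivatives_eq_off_zero[OF assms has_derivative_inner[OF has_derivative_ident G_deriv[OF assms]]
          has_derivative_const[of 0]]) (simp add: G_orth)
  then show "y \<bullet> D y v = - (v \<bullet> G y)" by simp
  have "G y \<bullet> D y v + D y v \<bullet> G y = y \<bullet> v + v \<bullet> y"
    by (rule derivatives_eq_off_zero[OF assms has_derivative_inner[OF G_deriv G_deriv, OF assms assms]
          has_derivative_inner[OF has_derivative_ident has_derivative_ident]]) (simp add: G_norm)
  then show "G y \<bullet> D y v = y \<bullet> v" by (simp add: inner_commute)
qed

text \<open>Differentiating both parts of \<open>G_D\<close> once more determines the components of
  \<open>B\<close> along \<open>y\<close> and \<open>G y\<close> from first derivatives
  alone.\<close>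

lemma B_vertical: assumes "y \<noteq> 0"
  shows "y \<bullet> B y u v = - (u \<bullet> D y v) - v \<bullet> D y u" "G y \<bullet> B y u v = u \<bullet> v - D y u \<bullet> D y v"
proof -
  have "y \<bullet> B y u v + u \<bullet> D y v = - (v \<bullet> D y u)"
    by (rule derivatives_eq_off_zero[OF assms has_derivative_inner[OF has_derivative_ident D_deriv[OF assms]]
          has_derivative_minus[OF has_derivative_inner_right[OF G_deriv[OF assms]]]]) (simp add: G_D)
  then show "y \<bullet> B y u v = - (u \<bullet> D y v) - v \<bullet> D y u" by simp
  have "G y \<bullet> B y u v + D y u \<bullet> D y v = u \<bullet> v"
    by (rule derivatives_eq_off_zero[OF assms has_derivative_inner[OF G_deriv[OF assms] D_deriv[OF assms]]
          has_derivative_inner_left[OF has_derivative_ident]]) (simp add: G_D)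
  then show "G y \<bullet> B y u v = u \<bullet> v - D y u \<bullet> D y v" by simp
qed

lemma D_hom: assumes "y \<noteq> 0" "s > 0" shows "D (s *\<^sub>R y) = D y"
proof
  fix v
  have "((\<lambda>z. G (s *\<^sub>R z)) has_derivative (\<lambda>v. D (s *\<^sub>R y) (s *\<^sub>R v))) (at y)"
    by (rule has_derivative_compose[OF _ G_deriv]) (use assms in \<open>auto intro!: derivative_eq_intros\<close>)
  moreover have "((\<lambda>z. s *\<^sub>R G z) has_derivative (\<lambda>v. s *\<^sub>R D y v)) (at y)"
    by (intro has_derivative_scaleR_right G_deriv assms)
  ultimately have "D (s *\<^sub>R y) (s *\<^sub>R v) = s *\<^sub>R D y v"
    by (rule derivatives_eq_off_zero[OF assms(1)]) (use G_hom assms in auto)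
  then show "D (s *\<^sub>R y) v = D y v"
    using assms by (simp add: lin_simps)
qed

lemma B_hom: assumes "y \<noteq> 0" "s > 0" shows "s *\<^sub>R B (s *\<^sub>R y) u v = B y u v"
proof -
  have "((\<lambda>z. D (s *\<^sub>R z) v) has_derivative (\<lambda>u. B (s *\<^sub>R y) (s *\<^sub>R u) v)) (at y)"
    by (rule has_derivative_compose[OF _ D_deriv]) (use assms in \<open>auto intro!: derivative_eq_intros\<close>)
  then have "B (s *\<^sub>R y) (s *\<^sub>R u) v = B y u v"
    by (rule derivatives_eq_off_zero[OF assms(1) _ D_deriv[OF assms(1)]]) (use D_hom assms in auto)
  then show ?thesis
    using assms by (simp add: lin_simps)
qed

text \<open>\<open>dv\<close> is the divergence (the trace of the derivative) and \<open>en\<close> the energy density \<open>\<bar>DG\<bar>\<^sup>2\<close>;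
  the suffixes 1 and 2 mark their first and second derivatives.\<close>

definition dv :: "real^4 \<Rightarrow> real" where "dv y = (\<Sum>e\<in>Basis. D y e \<bullet> e)"
definition en :: "real^4 \<Rightarrow> real" where "en y = (\<Sum>e\<in>Basis. D y e \<bullet> D y e)"
definition dv1 where "dv1 y u = (\<Sum>e\<in>Basis. B y u e \<bullet> e)"
definition dv2 where "dv2 y w u = (\<Sum>e\<in>Basis. C y w u e \<bullet> e)"
definition en1 where "en1 y u = (\<Sum>e\<in>Basis. 2 * (B y u e \<bullet> D y e))"
definition en2 where "en2 y w u = (\<Sum>e\<in>Basis. 2 * (C y w u e \<bullet> D y e + B y u e \<bullet> B y w e))"

lemma dv_deriv: "y \<noteq> 0 \<Longrightarrow> (dv has_derivative dv1 y) (at y)"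
  unfolding dv_def[abs_def] dv1_def[abs_def]
  by (intro has_derivative_sum has_derivative_inner_left D_deriv)

lemma dv1_deriv: "y \<noteq> 0 \<Longrightarrow> ((\<lambda>y. dv1 y u) has_derivative (\<lambda>w. dv2 y w u)) (at y)"
  unfolding dv1_def dv2_def
  by (intro has_derivative_sum has_derivative_inner_left B_deriv)

lemma en_deriv: assumes "y \<noteq> 0" shows "(en has_derivative en1 y) (at y)"
proof -
  have "(en has_derivative (\<lambda>u. \<Sum>e\<in>Basis. D y e \<bullet> B y u e + B y u e \<bullet> D y e)) (at y)"
    unfolding en_def[abs_def] by (intro has_derivative_sum has_derivative_inner D_deriv assms)
  then show ?thesis by (simp add: en1_def[abs_def] inner_commute)
qed

lemma en1_deriv: assumes "y \<noteq> 0" shows "((\<lambda>y. en1 y u) has_derivative (\<lambda>w. en2 y w u)) (at y)"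
proof -
  have "((\<lambda>y. en1 y u) has_derivative
     (\<lambda>w. \<Sum>e\<in>Basis. 2 * (B y u e \<bullet> B y w e + C y w u e \<bullet> D y e))) (at y)"
    unfolding en1_def
    by (intro has_derivative_sum has_derivative_mult_right has_derivative_inner D_deriv B_deriv assms)
  then show ?thesis by (simp add: en2_def add.commute)
qed

lemma dv_hom: "y \<noteq> 0 \<Longrightarrow> s > 0 \<Longrightarrow> dv (s *\<^sub>R y) = dv y"
  and en_hom: "y \<noteq> 0 \<Longrightarrow> s > 0 \<Longrightarrow> en (s *\<^sub>R y) = en y"
  by (simp_all add: dv_def en_def D_hom)

end

text \<open>The geometric hypotheses in flat terms: integral curves have acceleration
  \<open>- p\<close>, as great circles do, and harmonicity confines the Euclidean Laplacian to the
  plane of \<open>p\<close> and \<open>G p\<close>. Both are imposed on the sphere and spread by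
  homogeneity; \<open>Lap_eq\<close> identifies the coefficients.\<close>

locale harmonic_geodesic_ext = unit_field_ext +
  assumes D_G_sphere: "norm p = 1 \<Longrightarrow> D p (G p) = - p"
    and Lap_span_sphere: "norm p = 1 \<Longrightarrow> \<exists>a b. (\<Sum>e\<in>Basis. B p e e) = a *\<^sub>R p + b *\<^sub>R G p"
begin

section \<open>Consequences of geodesic integral curves and harmonicity\<close>

lemma D_G: assumes "y \<noteq> 0" shows "D y (G y) = - y"
proof -
  let ?p = "inverse (norm y) *\<^sub>R y"
  have p: "norm ?p = 1" using assms by simp
  have "inverse (norm y) *\<^sub>R D y (G y) = inverse (norm y) *\<^sub>R (- y)"
    using D_G_sphere[OF p] D_hom[OF assms, of "inverse (norm y)"] G_hom[OF assms, of "inverse (norm y)"] assms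
    by (simp add: lin_simps)
  then show ?thesis by (rule scaleR_left_imp_eq[rotated]) (use assms in simp)
qed

lemma Lap_span:
  assumes "y \<noteq> 0"
  shows "\<exists>a b. (\<Sum>e\<in>Basis. B y e e) = a *\<^sub>R y + b *\<^sub>R G y"
proof -
  let ?s = "inverse (norm y)"
  have p: "norm (?s *\<^sub>R y) = 1" using assms by simp
  have s: "?s > 0" using assms by simp
  obtain a b where "(\<Sum>e\<in>Basis. B (?s *\<^sub>R y) e e) = a *\<^sub>R (?s *\<^sub>R y) + b *\<^sub>R G (?s *\<^sub>R y)"
    using Lap_span_sphere[OF p] by blast
  then have "?s *\<^sub>R (\<Sum>e\<in>Basis. B (?s *\<^sub>R y) e e) = ?s *\<^sub>R (a *\<^sub>R (?s *\<^sub>R y) + b *\<^sub>R G (?s *\<^sub>R y))"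
    by simp
  then have "(\<Sum>e\<in>Basis. B y e e) = ?s *\<^sub>R (a *\<^sub>R (?s *\<^sub>R y) + b *\<^sub>R G (?s *\<^sub>R y))"
    unfolding scaleR_sum_right B_hom[OF assms s] .
  then show ?thesis unfolding G_hom[OF assms s] scaleR_add_right scaleR_scaleR by blast
qed

text \<open>Derivative of \<open>D y (G y) = - y\<close>. By symmetry of \<open>B\<close> this is a
  Riccati equation for \<open>D\<close> along the integral curves.\<close>

lemma B_G: assumes "y \<noteq> 0" shows "B y u (G y) = - u - D y (D y u)"
proof -
  have "B y u (G y) + D y (D y u) = - u"
    by (rule derivatives_eq_off_zero[OF assms D_moving[OF assms G_deriv[OF assms]] _ D_G])
      (auto intro!: derivative_eq_intros)
  then show ?thesis by (simp add: eq_diff_eq)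
qed

text \<open>Tracing \<open>B_vertical\<close> gives the pairings with \<open>y\<close> and
  \<open>G y\<close>, hence both coefficients; the 4 is the trace of the identity.\<close>

lemma Lap_eq:
  assumes "y \<noteq> 0"
  shows "(\<Sum>e\<in>Basis. B y e e) = inverse (y \<bullet> y) *\<^sub>R ((- 2 * dv y) *\<^sub>R y + (4 - en y) *\<^sub>R G y)"
proof -
  obtain a b where ab: "(\<Sum>e\<in>Basis. B y e e) = a *\<^sub>R y + b *\<^sub>R G y"
    using Lap_span[OF assms] by blast
  have "y \<bullet> (\<Sum>e\<in>Basis. B y e e) = - 2 * dv y"
    by (simp add: inner_sum_right B_vertical assms dv_def inner_commute sum_distrib_left)
  then have a: "a * (y \<bullet> y) = - 2 * dv y"
    unfolding ab by (simp add: inner_add_right G_orth assms)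
  have "G y \<bullet> (\<Sum>e\<in>Basis. B y e e) = 4 - en y"
    by (simp add: inner_sum_right B_vertical assms en_def sum_subtractf)
  then have b: "b * (y \<bullet> y) = 4 - en y"
    unfolding ab using G_orth[OF assms] by (simp add: inner_add_right inner_commute G_norm assms)
  show ?thesis
    unfolding ab a[symmetric] b[symmetric] using assms
    by (simp add: scaleR_add_right mult.commute[of "inverse (y \<bullet> y)"] mult.assoc)
qed

lemma Lap_deriv:
  assumes p: "norm p = 1"
  shows "(\<Sum>e\<in>Basis. C p w e e) = (- 2 * (p \<bullet> w)) *\<^sub>R ((- 2 * dv p) *\<^sub>R p + (4 - en p) *\<^sub>R G p)
     + (- 2 * dv1 p w) *\<^sub>R p + (- 2 * dv p) *\<^sub>R w - en1 p w *\<^sub>R G p + (4 - en p) *\<^sub>R D p w"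
proof -
  have p0: "p \<noteq> 0" and pp: "p \<bullet> p = 1" using p by (auto simp: norm_eq_1)
  have l: "((\<lambda>y. \<Sum>e\<in>Basis. B y e e) has_derivative (\<lambda>w. \<Sum>e\<in>Basis. C p w e e)) (at p)"
    by (intro has_derivative_sum B_deriv p0)
  have 1: "((\<lambda>y. inverse (y \<bullet> y)) has_derivative (\<lambda>w. - 2 * (p \<bullet> w))) (at p)"
    by (rule has_derivative_eq_rhs[OF Deriv.has_derivative_inverse[OF _
          has_derivative_inner[OF has_derivative_ident has_derivative_ident]]])
      (auto simp: pp inner_commute fun_eq_iff)
  have 2: "((\<lambda>y. (- 2 * dv y) *\<^sub>R y + (4 - en y) *\<^sub>R G y) has_derivative
     (\<lambda>w. ((- 2 * dv p) *\<^sub>R w + (- 2 * dv1 p w) *\<^sub>R p)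
       + ((4 - en p) *\<^sub>R D p w + (0 - en1 p w) *\<^sub>R G p))) (at p)"
    by (intro has_derivative_add has_derivative_scaleR has_derivative_ident has_derivative_mult_right
        has_derivative_diff has_derivative_const dv_deriv en_deriv G_deriv p0)
  have r: "((\<lambda>y. inverse (y \<bullet> y) *\<^sub>R ((- 2 * dv y) *\<^sub>R y + (4 - en y) *\<^sub>R G y)) has_derivative
     (\<lambda>w. (- 2 * (p \<bullet> w)) *\<^sub>R ((- 2 * dv p) *\<^sub>R p + (4 - en p) *\<^sub>R G p)
     + (- 2 * dv1 p w) *\<^sub>R p + (- 2 * dv p) *\<^sub>R w - en1 p w *\<^sub>R G p + (4 - en p) *\<^sub>R D p w)) (at p)"
    by (rule has_derivative_eq_rhs[OF has_derivative_scaleR[OF 1 2]]) (simp add: pp fun_eq_iff)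
  show ?thesis
    by (rule derivatives_eq_off_zero[OF p0 l r Lap_eq])
qed

text \<open>Differentiate \<open>B_G\<close> along \<open>G y\<close>. The second derivatives that
  appear either vanish by \<open>B_self\<close> or again have \<open>G y\<close> in a slot, where
  \<open>B_G\<close> removes them; a polynomial in \<open>D y\<close> remains.\<close>

lemma C_G: 
  assumes "y \<noteq> 0"
  shows "C y (G y) (G y) u = 2 *\<^sub>R (D y u + D y (D y (D y u)))"
proof -
  have "C y w u (G y) + B y u (D y w) = - (B y w (D y u) + D y (B y w u))" for w
  proof (rule derivatives_eq_off_zero[OF assms B_moving[OF assms G_deriv[OF assms]]])
    show "((\<lambda>y. - u - D y (D y u)) has_derivative (\<lambda>w. - (B y w (D y u) + D y (B y w u)))) (at y)"
      by (rule derivative_eq_intros D_moving[OF assms] D_deriv[OF assms] refl)+ simp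
  qed (rule B_G)
  from this[of "G y"] show ?thesis
    using B_sym[OF assms, of "G y"] C_sym'[OF assms, of _ u "G y"]
    by (simp add: D_G assms lin_simps B_self B_G scaleR_2 linear_diff[OF linear_D])
qed

text \<open>By \<open>G_D\<close>, \<open>D p\<close> preserves the plane orthogonal to
  \<open>p\<close> and \<open>G p\<close>. It rotates the plane of \<open>p\<close> and
  \<open>G p\<close>, so the 2x2 matrix with columns (a, c) and (b, m) carries the remaining
  first-order data.\<close>

lemma adapted_frame:
  assumes p: "norm p = 1"
  obtains f g a b c m where "onb4 p (G p) f g" "D p f = a *\<^sub>R f + c *\<^sub>R g" "D p g = b *\<^sub>R f + m *\<^sub>R g"
proof -
  have p0: "p \<noteq> 0" and pp: "p \<bullet> p = 1" using p by (auto simp: norm_eq_1)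
  obtain f g where o: "onb4 p (G p) f g"
    using extend_onb4[of p "G p"] pp G_norm[OF p0] G_orth[OF p0] by auto
  note oo = o[unfolded onb4_def]
  have "D p v = (D p v \<bullet> f) *\<^sub>R f + (D p v \<bullet> g) *\<^sub>R g" if "v = f \<or> v = g" for v
  proof -
    have "D p v \<bullet> p = 0" "D p v \<bullet> G p = 0"
      using that oo G_D[OF p0, of v] by (auto simp: inner_commute)
    then show ?thesis using onb4_expand[OF o, of "D p v"] by simp
  qed
  then show thesis using that[OF o] by blast
qed

text \<open>Symmetry of third derivatives makes the Laplacian commute with the divergence.\<close>

lemma Lap_dv: 
  assumes "p \<noteq> 0"
  shows "(\<Sum>u\<in>Basis. dv2 p u u) = (\<Sum>e\<in>Basis. (\<Sum>u\<in>Basis. C p e u u) \<bullet> e)"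
proof -
  have "C p u u e = C p e u u" for u e
    using C_sym[OF assms] C_sym'[OF assms] by metis
  then show ?thesis
    unfolding dv2_def by (subst sum.swap) (simp add: inner_sum_left)
qed

text \<open>The product rule produces the squared norm of \<open>B\<close>; symmetry of third
  derivatives turns the other term into the derivative of the Laplacian paired with
  \<open>D p\<close>.\<close>

lemma Lap_en: 
  assumes "p \<noteq> 0"
  shows "(\<Sum>u\<in>Basis. en2 p u u) = 2 * (\<Sum>e\<in>Basis. (\<Sum>u\<in>Basis. C p e u u) \<bullet> D p e)
     + 2 * (\<Sum>u\<in>Basis. \<Sum>e\<in>Basis. B p u e \<bullet> B p u e)"
proof -
  have c: "C p u u e = C p e u u" for u e
    using C_sym[OF assms] C_sym'[OF assms] by metis
  have "en2 p u u = (\<Sum>e\<in>Basis. 2 * (C p e u u \<bullet> D p e + B p u e \<bullet> B p u e))" for u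
    unfolding en2_def by (intro sum.cong refl) (simp only: c[of u])
  then have "(\<Sum>u\<in>Basis. en2 p u u) = 2 * (\<Sum>u\<in>Basis. \<Sum>e\<in>Basis. C p e u u \<bullet> D p e)
     + 2 * (\<Sum>u\<in>Basis. \<Sum>e\<in>Basis. B p u e \<bullet> B p u e)"
    by (simp add: sum.distrib sum_distrib_left distrib_left)
  then show ?thesis
    by (subst (asm) sum.swap) (simp add: inner_sum_left)
qed

lemmas inner_lin = inner_add_left inner_add_right inner_diff_left inner_diff_right

section \<open>Traces and norms in an adapted orthonormal frame\<close>

context
  fixes p f g :: "real^4" and a b c m :: real
  assumes p: "norm p = 1" and o: "onb4 p (G p) f g"
    and Df: "D p f = a *\<^sub>R f + c *\<^sub>R g" and Dg: "D p g = b *\<^sub>R f + m *\<^sub>R g"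
begin

lemma frame_p_nonzero: "p \<noteq> 0" using p by auto

lemma frame_inner:
  "p \<bullet> p = 1" "G p \<bullet> G p = 1" "f \<bullet> f = 1" "g \<bullet> g = 1"
  "p \<bullet> G p = 0" "p \<bullet> f = 0" "p \<bullet> g = 0" "G p \<bullet> f = 0" "G p \<bullet> g = 0" "f \<bullet> g = 0"
  "G p \<bullet> p = 0" "f \<bullet> p = 0" "g \<bullet> p = 0" "f \<bullet> G p = 0" "g \<bullet> G p = 0" "g \<bullet> f = 0"
  using o by (auto simp: onb4_def inner_commute)

lemmas frame_simps = frame_inner Df Dg D_self[OF frame_p_nonzero] D_G[OF frame_p_nonzero] B_self[OF frame_p_nonzero] B_G[OF frame_p_nonzero] lin_simps[OF frame_p_nonzero]
  linear_diff[OF linear_D[OF frame_p_nonzero]] linear_0[OF linear_D[OF frame_p_nonzero]]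

lemma frame_dv: "dv p = a + m"
  unfolding dv_def
  by (subst trace_onb4[OF o]) (auto intro!: linearI simp: frame_simps inner_lin)

lemma frame_en: "en p = 2 + a\<^sup>2 + b\<^sup>2 + c\<^sup>2 + m\<^sup>2"
  unfolding en_def
  by (subst trace_onb4[OF o])
    (auto intro!: linearI simp: frame_simps inner_lin power2_eq_square algebra_simps)

text \<open>The second formula is the trace of \<open>B_G\<close>: the plane of \<open>p\<close> and
  \<open>G p\<close> contributes nothing, and the quadratic terms are the trace of the square of the
  2x2 matrix.\<close>

lemma frame_dv1: "dv1 p p = 0" "dv1 p (G p) = - 2 - a\<^sup>2 - 2 * b * c - m\<^sup>2"
proof -
  show "dv1 p p = 0" by (simp add: dv1_def B_self frame_p_nonzero)
  show "dv1 p (G p) = - 2 - a\<^sup>2 - 2 * b * c - m\<^sup>2"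
    unfolding dv1_def
    by (subst trace_onb4[OF o])
      (auto intro!: linearI simp: frame_simps B_sym[OF frame_p_nonzero, of "G p"] inner_lin power2_eq_square algebra_simps)
qed

lemma frame_en1: "en1 p p = 0"
  "en1 p (G p) = - 2 * (a + m + a^3 + m^3 + a*b*c + b*c*m + (a + m) * (b\<^sup>2 + c\<^sup>2))"
proof -
  show "en1 p p = 0" by (simp add: en1_def B_self frame_p_nonzero)
  show "en1 p (G p) = - 2 * (a + m + a^3 + m^3 + a*b*c + b*c*m + (a + m) * (b\<^sup>2 + c\<^sup>2))"
    unfolding en1_def
    by (subst trace_onb4[OF o])
      (auto intro!: linearI simp: frame_simps B_sym[OF frame_p_nonzero, of "G p"] inner_lin power2_eq_square power3_eq_cube algebra_simps)
qed

text \<open>By \<open>C_G\<close> this is twice the trace of the 2x2 matrix plus its cube; on the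
  plane of \<open>p\<close> and \<open>G p\<close> the two terms cancel because \<open>D p\<close>
  squares to -1 there.\<close>

lemma frame_dv2: "dv2 p (G p) (G p) = 2 * (a + m + a^3 + m^3 + 3*b*c*(a + m))"
proof -
  let ?b = "\<lambda>u v. (2 *\<^sub>R (D p u + D p (D p (D p u)))) \<bullet> v"
  have 1: "linear (\<lambda>u. ?b u v)" for v
    by (rule linearI) (simp_all add: lin_simps[OF frame_p_nonzero] inner_lin distrib_left)
  have 2: "linear (?b u)" for u
    by (rule linearI) (simp_all add: inner_lin)
  show ?thesis
    unfolding dv2_def C_G[OF frame_p_nonzero] trace_onb4[OF o, where b = ?b, OF 1 2]
    by (simp add: frame_simps inner_lin) (simp add: power3_eq_cube algebra_simps)
qed

text \<open>After cancellation the trace of \<open>Lap_deriv\<close> is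
  \<open>- en1 p (G p) - en p * dv p\<close>, which \<open>frame_en\<close> and
  \<open>frame_en1\<close> turn into the product on the right.\<close>

lemma frame_Lap_dv:
  "dv2 p p p + dv2 p (G p) (G p) + dv2 p f f + dv2 p g g = (a + m) * ((a - m)\<^sup>2 + (b + c)\<^sup>2)"
proof -
  let ?b = "\<lambda>e v. (\<Sum>u\<in>Basis. C p e u u) \<bullet> v"
  have 1: "linear (\<lambda>u. ?b u v)" for v
    by (rule linearI) (simp_all add: lin_simps[OF frame_p_nonzero] inner_lin sum.distrib inner_sum_left sum_distrib_left)
  have 2: "linear (?b u)" for u
    by (rule linearI) (simp_all add: inner_lin)
  have "dv2 p p p + dv2 p (G p) (G p) + dv2 p f f + dv2 p g g = (\<Sum>u\<in>Basis. dv2 p u u)"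
    by (rule trace_onb4[OF o, symmetric])
      (auto intro!: linearI simp: dv2_def frame_simps inner_lin sum.distrib sum_distrib_left)
  also have "\<dots> = (a + m) * ((a - m)\<^sup>2 + (b + c)\<^sup>2)"
    unfolding Lap_dv[OF frame_p_nonzero]
    unfolding trace_onb4[OF o, where b = ?b, OF 1 2]
    by (simp add: Lap_deriv[OF p] frame_simps frame_dv frame_en frame_dv1 frame_en1 inner_lin)
       (simp add: power2_eq_square power3_eq_cube algebra_simps)
  finally show ?thesis .
qed

lemma frame_norm_ge: "w \<bullet> w \<ge> (p \<bullet> w)\<^sup>2 + (G p \<bullet> w)\<^sup>2"
proof -
  have "w \<bullet> w = (w \<bullet> p)\<^sup>2 + (w \<bullet> G p)\<^sup>2 + (w \<bullet> f)\<^sup>2 + (w \<bullet> g)\<^sup>2"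
    using arg_cong[OF onb4_expand[OF o, of w], of "\<lambda>v. w \<bullet> v"]
    by (simp add: inner_lin power2_eq_square)
  then show ?thesis by (simp add: inner_commute)
qed

text \<open>Keep only the entries of \<open>B\<close> with both arguments in {f, g}, and of these
  only the components along \<open>p\<close> and \<open>G p\<close>, known from
  \<open>B_vertical\<close>. The factor 2 counts the mixed entry twice.\<close>

lemma frame_B_norm_ge:
  "(\<Sum>u\<in>Basis. \<Sum>e\<in>Basis. B p u e \<bullet> B p u e) \<ge>
     4 * a\<^sup>2 + (1 - a\<^sup>2 - c\<^sup>2)\<^sup>2 + 4 * m\<^sup>2 + (1 - b\<^sup>2 - m\<^sup>2)\<^sup>2 + 2 * ((b + c)\<^sup>2 + (a * b + c * m)\<^sup>2)"
proof -
  have lin: "linear (\<lambda>u. \<Sum>e\<in>Basis. B p u e \<bullet> B p v e)" "linear (\<lambda>v. \<Sum>e\<in>Basis. B p u e \<bullet> B p v e)" for u v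
    by (rule linearI; simp add: lin_simps[OF frame_p_nonzero] inner_lin sum.distrib sum_distrib_left)+
  have lin': "linear (\<lambda>u. B p w u \<bullet> B p w v)" "linear (\<lambda>v. B p w u \<bullet> B p w v)" for u v w
    by (rule linearI; simp add: lin_simps[OF frame_p_nonzero] inner_lin)+
  have row: "(\<Sum>e\<in>Basis. B p w e \<bullet> B p w e) \<ge> B p w f \<bullet> B p w f + B p w g \<bullet> B p w g" for w
    unfolding trace_onb4[OF o, where b = "\<lambda>u v. B p w u \<bullet> B p w v", OF lin'] by simp
  have row0: "(\<Sum>e\<in>Basis. B p w e \<bullet> B p w e) \<ge> 0" for w
    by (simp add: sum_nonneg)
  have "(\<Sum>u\<in>Basis. \<Sum>e\<in>Basis. B p u e \<bullet> B p u e) \<ge>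
      B p f f \<bullet> B p f f + B p f g \<bullet> B p f g + (B p g f \<bullet> B p g f + B p g g \<bullet> B p g g)"
    unfolding trace_onb4[OF o, where b = "\<lambda>u v. \<Sum>e\<in>Basis. B p u e \<bullet> B p v e", OF lin]
    using row[of f] row[of g] row0[of p] row0[of "G p"] by linarith
  moreover have "B p f f \<bullet> B p f f \<ge> 4 * a\<^sup>2 + (1 - a\<^sup>2 - c\<^sup>2)\<^sup>2"
    using frame_norm_ge[of "B p f f"]
    by (simp add: B_vertical[OF frame_p_nonzero] frame_simps inner_lin) (simp add: power2_eq_square algebra_simps)
  moreover have "B p g g \<bullet> B p g g \<ge> 4 * m\<^sup>2 + (1 - b\<^sup>2 - m\<^sup>2)\<^sup>2"
    using frame_norm_ge[of "B p g g"]
    by (simp add: B_vertical[OF frame_p_nonzero] frame_simps inner_lin) (simp add: power2_eq_square algebra_simps)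
  moreover have "B p f g \<bullet> B p f g \<ge> (b + c)\<^sup>2 + (a * b + c * m)\<^sup>2"
    using frame_norm_ge[of "B p f g"]
    by (simp add: B_vertical[OF frame_p_nonzero] frame_simps inner_lin) (simp add: power2_eq_square algebra_simps)
  ultimately show ?thesis using B_sym[OF frame_p_nonzero, of g f] by simp
qed

text \<open>The contributions of \<open>p\<close> and \<open>G p\<close> cancel. The plane of
  \<open>f\<close> and \<open>g\<close> leaves \<open>4 - en p\<close> times the squared norm of the
  2x2 matrix, which is \<open>en p - 2\<close>.\<close>

lemma frame_gradient_Lap:
  assumes "dv p = 0" "\<And>u. dv1 p u = 0"
  shows "(\<Sum>e\<in>Basis. (\<Sum>u\<in>Basis. C p e u u) \<bullet> D p e) = (4 - en p) * (en p - 2)"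
proof -
  let ?b = "\<lambda>e v. (\<Sum>u\<in>Basis. C p e u u) \<bullet> D p v"
  have 1: "linear (\<lambda>u. ?b u v)" for v
    by (rule linearI) (simp_all add: lin_simps[OF frame_p_nonzero] inner_lin sum.distrib inner_sum_left sum_distrib_left)
  have 2: "linear (?b u)" for u
    by (rule linearI) (simp_all add: lin_simps[OF frame_p_nonzero] inner_lin)
  have e: "en p = 2 + (a\<^sup>2 + c\<^sup>2) + (b\<^sup>2 + m\<^sup>2)" by (simp add: frame_en)
  show ?thesis
    unfolding trace_onb4[OF o, where b = ?b, OF 1 2]
    by (simp add: Lap_deriv[OF p] assms frame_simps frame_en1(1) inner_lin)
      (simp add: e power2_eq_square algebra_simps)
qed

end

text \<open>At a maximum of \<open>dv\<close> the derivative along \<open>G p\<close> vanishes, which determines \<open>b * c\<close> and makes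
  the second derivative along \<open>G p\<close> equal to \<open>- dv * (4 + dv\<^sup>2)\<close>, while the Laplacian of \<open>dv\<close> is a nonnegative
  multiple of \<open>dv\<close>; so \<open>dv\<close> cannot be positive there. The sign \<open>\<sigma>\<close> treats minima alongside.\<close>

lemma dv_eq_0:
  assumes "y \<noteq> 0"
  shows "dv y = 0"
proof -
  have le: "\<sigma> * dv y \<le> 0" if \<sigma>: "\<sigma> = 1 \<or> \<sigma> = - 1" and y: "y \<noteq> 0" for \<sigma> y
  proof -
    have "continuous_on (sphere 0 1) (\<lambda>y. \<sigma> * dv y)"
    proof (rule continuous_at_imp_continuous_on, intro ballI)
      fix y :: "real^4" assume "y \<in> sphere 0 1"
      then have "y \<noteq> 0" by auto
      then show "isCont (\<lambda>y. \<sigma> * dv y) y"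
        by (intro continuous_mult continuous_const has_derivative_continuous[OF dv_deriv])
    qed
    moreover have "sphere (0::real^4) 1 \<noteq> {}" by simp
    ultimately obtain p where "p \<in> sphere 0 1" and mx: "\<And>y. y \<in> sphere 0 1 \<Longrightarrow> \<sigma> * dv y \<le> \<sigma> * dv p"
      using continuous_attains_sup[OF compact_sphere, of 0 1 "\<lambda>y. \<sigma> * dv y"] by blast
    then have p: "norm p = 1" by simp
    then have p0: "p \<noteq> 0" by auto
    have mxd: "\<sigma> * dv1 p u = 0" "\<sigma> * dv2 p u u \<le> 0" for u
      by (rule max_on_sphere_derivatives[OF has_derivative_mult_right[OF dv_deriv]
            has_derivative_mult_right[OF dv1_deriv[OF p0]] _ p], assumption, simp add: dv_hom, simp add: mx)+
    obtain f g a b c m where fr: "onb4 p (G p) f g" "D p f = a *\<^sub>R f + c *\<^sub>R g" "D p g = b *\<^sub>R f + m *\<^sub>R g"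
      using adapted_frame[OF p] .
    note F = frame_dv[OF p fr] frame_dv1(2)[OF p fr] frame_dv2[OF p fr] frame_Lap_dv[OF p fr]
    have "dv1 p (G p) = 0" using mxd(1) \<sigma> by auto
    then have bc: "2 * b * c = - 2 - a\<^sup>2 - m\<^sup>2" using F(2) by simp
    have "dv2 p (G p) (G p) = - (a + m) * (4 + (a + m)\<^sup>2)"
    proof -
      have "dv2 p (G p) (G p) = 2 * (a + m + a^3 + m^3) + 3 * (2 * b * c) * (a + m)"
        unfolding F(3) by (simp add: algebra_simps)
      then show ?thesis
        unfolding bc by (simp add: power2_eq_square power3_eq_cube algebra_simps)
    qed
    \<comment> \<open>Removing the known term along \<open>G p\<close> from the Laplacian leaves
      three second derivatives, each nonpositive once multiplied by \<open>\<sigma>\<close>.\<close>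
    moreover have "(a + m) * ((a - m)\<^sup>2 + (b + c)\<^sup>2) - dv2 p (G p) (G p) = dv2 p p p + dv2 p f f + dv2 p g g"
      unfolding F(4)[symmetric] by simp
    ultimately have "(a + m) * ((a - m)\<^sup>2 + (b + c)\<^sup>2 + (4 + (a + m)\<^sup>2)) = dv2 p p p + dv2 p f f + dv2 p g g"
      by (simp add: algebra_simps)
    then have "\<sigma> * (a + m) * ((a - m)\<^sup>2 + (b + c)\<^sup>2 + (4 + (a + m)\<^sup>2))
        = \<sigma> * dv2 p p p + \<sigma> * dv2 p f f + \<sigma> * dv2 p g g"
      unfolding mult.assoc by (simp only: distrib_left[of \<sigma>])
    also have "\<dots> \<le> 0"
      by (intro add_nonpos_nonpos mxd(2))
    finally have key: "\<sigma> * (a + m) * ((a - m)\<^sup>2 + (b + c)\<^sup>2 + (4 + (a + m)\<^sup>2)) \<le> 0" .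
    have "\<sigma> * dv p \<le> 0"
    proof (rule ccontr)
      assume "\<not> \<sigma> * dv p \<le> 0"
      then have s: "\<sigma> * (a + m) > 0" using F(1) by simp
      have "0 < (a - m)\<^sup>2 + (b + c)\<^sup>2 + (4 + (a + m)\<^sup>2)"
        by (intro add_nonneg_pos add_pos_nonneg add_nonneg_nonneg) auto
      then have "0 < \<sigma> * (a + m) * ((a - m)\<^sup>2 + (b + c)\<^sup>2 + (4 + (a + m)\<^sup>2))"
        by (rule mult_pos_pos[OF s])
      then show False using key by simp
    qed
    moreover have "\<sigma> * dv y \<le> \<sigma> * dv p"
      using mx[of "inverse (norm y) *\<^sub>R y"] dv_hom[OF y, of "inverse (norm y)"] y by simp
    ultimately show ?thesis by linarith
  qed
  show ?thesis using le[of 1 y] le[of "-1" y] assms by simp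
qed

lemma dv1_eq_0: "y \<noteq> 0 \<Longrightarrow> dv1 y u = 0"
  by (rule derivatives_eq_off_zero[OF _ dv_deriv has_derivative_const[of 0]]) (auto simp: dv_eq_0)

text \<open>Bochner's formula: half the Laplacian of \<open>en\<close> is \<open>\<bar>B\<bar>\<^sup>2\<close> plus the pairing of \<open>DG\<close> with the derivative
  of the Laplacian of \<open>G\<close>. The components of \<open>B\<close> along \<open>p\<close> and \<open>G p\<close> alone already outweigh the second term.\<close>

lemma en_facts:
  assumes p: "norm p = 1"
  shows "en p \<ge> 4"
    and "onb4 p (G p) f g \<Longrightarrow> en2 p p p + en2 p (G p) (G p) + en2 p f f + en2 p g g =
      2 * ((4 - en p) * (en p - 2)) + 2 * (\<Sum>u\<in>Basis. \<Sum>e\<in>Basis. B p u e \<bullet> B p u e)"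
    and "onb4 p (G p) f g \<Longrightarrow> en2 p p p + en2 p (G p) (G p) + en2 p f f + en2 p g g \<ge> 4 * (en p - 4)"
proof -
  have p0: "p \<noteq> 0" using p by auto
  obtain f' g' a b c m where fr: "onb4 p (G p) f' g'" "D p f' = a *\<^sub>R f' + c *\<^sub>R g'" "D p g' = b *\<^sub>R f' + m *\<^sub>R g'"
    using adapted_frame[OF p] .
  \<comment> \<open>Vanishing of \<open>dv\<close> and of its derivative along \<open>G p\<close>
    gives the 2x2 matrix trace 0 and determinant 1.\<close>
  have m: "m = - a" using frame_dv[OF p fr] dv_eq_0[OF p0] by simp
  then have bc: "b * c = - 1 - a\<^sup>2"
    using frame_dv1(2)[OF p fr] dv1_eq_0[OF p0] by simp
  have e: "en p = 2 + 2 * a\<^sup>2 + b\<^sup>2 + c\<^sup>2" using frame_en[OF p fr] m by simp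
  have "en p - 4 = 4 * a\<^sup>2 + (b + c)\<^sup>2"
    unfolding e power2_sum using bc by simp
  then show "en p \<ge> 4" by (smt (verit) zero_le_power2)
  \<comment> \<open>Splitting off \<open>2 * (en p - 4)\<close> leaves a remainder in
    \<open>a\<^sup>2\<close> and \<open>b * c\<close> alone, which the determinant condition
    annihilates.\<close>
  have "4 * a\<^sup>2 + (1 - a\<^sup>2 - c\<^sup>2)\<^sup>2 + 4 * m\<^sup>2 + (1 - b\<^sup>2 - m\<^sup>2)\<^sup>2 + 2 * ((b + c)\<^sup>2 + (a * b + c * m)\<^sup>2)
      + (4 - en p) * (en p - 2) = 2 * (en p - 4) + (6 + 4 * a\<^sup>2 - 2 * (a\<^sup>2)\<^sup>2 - 2 * (b * c)\<^sup>2 + 4 * (b * c) - 4 * a\<^sup>2 * (b * c))"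
    unfolding e m by (simp add: power2_eq_square algebra_simps)
  moreover have "6 + 4 * a\<^sup>2 - 2 * (a\<^sup>2)\<^sup>2 - 2 * (b * c)\<^sup>2 + 4 * (b * c) - 4 * a\<^sup>2 * (b * c) = 0"
    unfolding bc by (simp add: power2_eq_square algebra_simps)
  ultimately have "2 * (en p - 4) \<le> (4 - en p) * (en p - 2) + (\<Sum>u\<in>Basis. \<Sum>e\<in>Basis. B p u e \<bullet> B p u e)"
    using frame_B_norm_ge[OF p fr] by linarith
  from mult_left_mono[OF this, of 2]
  have ge: "4 * (en p - 4) \<le> 2 * ((4 - en p) * (en p - 2)) + 2 * (\<Sum>u\<in>Basis. \<Sum>e\<in>Basis. B p u e \<bullet> B p u e)"
    by (simp add: distrib_left)
  show *: "en2 p p p + en2 p (G p) (G p) + en2 p f f + en2 p g g =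
      2 * ((4 - en p) * (en p - 2)) + 2 * (\<Sum>u\<in>Basis. \<Sum>e\<in>Basis. B p u e \<bullet> B p u e)"
    if "onb4 p (G p) f g"
  proof -
    have "onb4 p (G p) f g \<Longrightarrow> en2 p p p + en2 p (G p) (G p) + en2 p f f + en2 p g g = (\<Sum>u\<in>Basis. en2 p u u)"
      by (rule trace_onb4[symmetric]; (assumption | rule linearI);
        simp add: en2_def lin_simps[OF p0] inner_lin sum.distrib sum_distrib_left distrib_left ac_simps)
    then show ?thesis
      using that Lap_en[OF p0] frame_gradient_Lap[OF p fr dv_eq_0[OF p0] dv1_eq_0[OF p0]] by simp
  qed
  show "en2 p p p + en2 p (G p) (G p) + en2 p f f + en2 p g g \<ge> 4 * (en p - 4)" if "onb4 p (G p) f g"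
    unfolding *[OF that] by (rule ge)
qed

text \<open>At a maximum the trace of second derivatives is nonpositive, yet \<open>en_facts\<close>
  bounds it below by \<open>4 * (en p - 4)\<close>; so the maximum is at most 4, which is also the
  lower bound.\<close>

lemma en_eq_4:
  assumes y: "y \<noteq> 0"
  shows "en y = 4"
proof -
  have "continuous_on (sphere 0 1) en"
  proof (rule continuous_at_imp_continuous_on, intro ballI)
    fix y :: "real^4" assume "y \<in> sphere 0 1"
    then have "y \<noteq> 0" by auto
    then show "isCont en y" by (rule has_derivative_continuous[OF en_deriv])
  qed
  moreover have "sphere (0::real^4) 1 \<noteq> {}" by simp
  ultimately obtain p where "p \<in> sphere 0 1" and mx: "\<And>y. y \<in> sphere 0 1 \<Longrightarrow> en y \<le> en p"
    using continuous_attains_sup[OF compact_sphere, of 0 1 en] by blast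
  then have p: "norm p = 1" by simp
  then have p0: "p \<noteq> 0" by auto
  have mxd: "en2 p u u \<le> 0" for u
    by (rule max_on_sphere_derivatives(2)[OF en_deriv en1_deriv[OF p0] _ p])
      (assumption, simp add: en_hom, simp add: mx)
  obtain f g where o: "onb4 p (G p) f g"
    using adapted_frame[OF p] .
  have "en2 p p p + en2 p (G p) (G p) + en2 p f f + en2 p g g \<le> 0"
    by (intro add_nonpos_nonpos mxd)
  then have "4 * (en p - 4) \<le> 0"
    by (rule order_trans[OF en_facts(3)[OF p o]])
  then have "en p \<le> 4" by simp
  moreover have "en y \<le> en p" "en y \<ge> 4"
    using mx[of "inverse (norm y) *\<^sub>R y"] en_hom[OF y, of "inverse (norm y)"] y
      en_facts(1)[of "inverse (norm y) *\<^sub>R y"] by simp_all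
  ultimately show ?thesis by linarith
qed

text \<open>With \<open>en\<close> constantly 4, Bochner's identity reduces to the vanishing of the
  squared norm of \<open>B\<close>.\<close>

lemma B_eq_0:
  assumes "y \<noteq> 0"
  shows "B y u v = 0"
proof -
  define p where "p = inverse (norm y) *\<^sub>R y"
  have p: "norm p = 1" using assms by (simp add: p_def)
  then have p0: "p \<noteq> 0" by auto
  have en1: "en1 z u = 0" if "z \<noteq> 0" for z u
    by (rule derivatives_eq_off_zero[OF that en_deriv[OF that] has_derivative_const[of 4]]) (simp add: en_eq_4)
  have en2: "en2 p w u = 0" for w u
    by (rule derivatives_eq_off_zero[OF p0 en1_deriv[OF p0] has_derivative_const[of 0]]) (simp add: en1)
  obtain f g where o: "onb4 p (G p) f g"
    using adapted_frame[OF p] .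
  have "(\<Sum>u\<in>Basis. \<Sum>e\<in>Basis. B p u e \<bullet> B p u e) = 0"
    using en_facts(2)[OF p o] by (simp add: en2 en_eq_4 p0)
  then have "\<forall>u\<in>Basis. (\<Sum>e\<in>Basis. B p u e \<bullet> B p u e) = 0"
    by (subst (asm) sum_nonneg_eq_0_iff) (auto intro: sum_nonneg)
  then have "\<forall>u\<in>Basis. \<forall>e\<in>Basis. B p u e \<bullet> B p u e = 0"
    by (subst (asm) sum_nonneg_eq_0_iff) auto
  then have bas: "B p u e = 0" if "u \<in> Basis" "e \<in> Basis" for u e
    using that by simp
  have row: "B p u e = 0" if "u \<in> Basis" for u e
    by (rule linear_eq_0_on_span[OF linear_B2[OF p0], of Basis]) (simp_all add: that bas)
  have "B p u v = 0"
    by (rule linear_eq_0_on_span[OF linear_B1[OF p0], of Basis]) (simp_all add: row)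
  then show ?thesis
    using B_hom[OF assms, of "inverse (norm y)" u v] assms by (simp add: p_def)
qed

text \<open>\<open>D\<close> has zero derivative on the connected punctured space, hence is
  constant; \<open>D_self\<close> then makes \<open>G\<close> linear off the origin, and
  \<open>D_G\<close> gives the square.\<close>

lemma linear_complex_structure:
  obtains J where "linear J" "\<And>y. y \<noteq> 0 \<Longrightarrow> G y = J y" "\<And>y. J (J y) = - y"
proof -
  have conn: "connected (- {0 :: real^4})"
    using connected_punctured_universe[of "0 :: real^4"] by simp
  obtain q :: "real^4" where q: "q \<noteq> 0" using zero_neq_one[where 'a = "real^4"] by metis
  have const: "D y v = D q v" if "y \<noteq> 0" for y v
  proof -
    have "(\<lambda>y. D y v) y = (\<lambda>y. D y v) q"
      by (rule has_derivative_zero_unique_connected[OF _ conn])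
        (use D_deriv q that in \<open>auto simp: B_eq_0\<close>)
    then show ?thesis .
  qed
  have G: "G y = D q y" if "y \<noteq> 0" for y
    using D_self[OF that] const[OF that] by simp
  show thesis
  proof (rule that[of "D q"])
    show "linear (D q)" by (rule linear_D[OF q])
    show "D q (D q y) = - y" for y
    proof (cases "y = 0")
      case True
      then show ?thesis using linear_0[OF linear_D[OF q]] by simp
    next
      case False
      then show ?thesis using D_G[OF False] G[OF False] const[OF False] by simp
    qed
  qed (use G in auto)
qed

end

section \<open>Great circles and harmonicity in terms of the extension\<close>

lemma hom_ext_sphere: "norm p = 1 \<Longrightarrow> hom_ext f p = f p"
  by (simp add: hom_ext_def)

text \<open>The part of \<open>v\<close> orthogonal to \<open>W\<close> pairs to zero with the curve
  at all times, hence also with its derivative.\<close>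

lemma subspace_has_vector_derivative:
  fixes c :: "real \<Rightarrow> 'a::euclidean_space"
  assumes W: "subspace W" and c: "\<And>t. c t \<in> W" and d: "(c has_vector_derivative v) (at t)"
  shows "v \<in> W"
proof -
  obtain a z where az: "a \<in> span W" "\<And>w. w \<in> span W \<Longrightarrow> orthogonal z w" "v = a + z"
    using orthogonal_subspace_decomp_exists[of W v] by metis
  have "(\<lambda>t. z \<bullet> c t) = (\<lambda>t. 0)"
    using az(2) c by (auto simp: orthogonal_def span_base)
  moreover have "((\<lambda>t. z \<bullet> c t) has_vector_derivative z \<bullet> v) (at t)"
    using bounded_linear.has_vector_derivative[OF bounded_linear_inner_right d] .
  ultimately have "z \<bullet> v = 0"
    by (metis vector_derivative_at has_vector_derivative_const)
  moreover have "z \<bullet> a = 0" using az(1,2) by (auto simp: orthogonal_def)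
  ultimately have "z \<bullet> z = 0" using az(3) by (simp add: inner_add_right)
  then show ?thesis using az(1,3) W by (simp add: span_eq_iff[THEN iffD2])
qed

section \<open>Integral curves of the extension and the intrinsic Hessian\<close>

context unit_field_ext
begin

text \<open>\<open>D\<close> is constant along rays, so compactness of the sphere bounds it
  everywhere. The normalisation \<open>L \<ge> 1\<close> serves segments through the origin in
  \<open>G_lipschitz\<close>.\<close>

lemma D_bounded:
  obtains L where "L \<ge> 1" "\<And>y v. y \<noteq> 0 \<Longrightarrow> norm (D y v) \<le> L * norm v"
proof -
  let ?n = "\<lambda>y. \<Sum>b\<in>Basis. norm (D y b)"
  have "continuous_on (sphere 0 1) ?n"
  proof (intro continuous_on_sum continuous_on_norm continuous_at_imp_continuous_on ballI)
    fix y b :: "real^4" assume "y \<in> sphere 0 1"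
    then have "y \<noteq> 0" by auto
    then show "isCont (\<lambda>y. D y b) y" using D_deriv has_derivative_continuous by blast
  qed
  then have "compact (?n ` sphere 0 1)" by (rule compact_continuous_image) simp
  then have "bounded (?n ` sphere 0 1)" by (rule compact_imp_bounded)
  then obtain M where M0: "\<forall>x\<in>?n ` sphere 0 1. \<bar>x\<bar> \<le> M"
    unfolding bounded_real by blast
  have M: "?n y \<le> M" if "norm y = 1" for y
    by (rule abs_le_D1, rule bspec[OF M0]) (simp add: that)
  show thesis
  proof (rule that[of "max 1 M"])
    fix y v :: "real^4" assume y: "y \<noteq> 0"
    let ?p = "inverse (norm y) *\<^sub>R y"
    have "D y v = (\<Sum>b\<in>Basis. (v \<bullet> b) *\<^sub>R D y b)"
      using linear_sum[OF linear_D[OF y], of "\<lambda>b. (v \<bullet> b) *\<^sub>R b" Basis] linear_scale[OF linear_D[OF y]]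
      by (simp add: euclidean_representation)
    also have "norm \<dots> \<le> (\<Sum>b\<in>Basis. norm v * norm (D y b))"
      by (rule sum_norm_le) (auto intro!: mult_right_mono Basis_le_norm)
    also have "\<dots> = ?n ?p * norm v"
      using D_hom[OF y, of "inverse (norm y)"] y by (simp add: sum_distrib_left mult.commute)
    also have "\<dots> \<le> max 1 M * norm v"
      using M[of ?p] y by (intro mult_right_mono) auto
    finally show "norm (D y v) \<le> max 1 M * norm v" .
  qed simp
qed

text \<open>Off the origin this is the mean value inequality. On a segment through the origin, where
  \<open>G\<close> may fail to be differentiable, norm preservation and
  \<open>norm x + norm y = norm (x - y)\<close> take over.\<close>

lemma G_lipschitz:
  assumes G0: "G 0 = 0"
  obtains L where "L \<ge> 0" "\<And>x y. norm (G x - G y) \<le> L * norm (x - y)"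
proof -
  obtain L where L: "L \<ge> 1" "\<And>y v. y \<noteq> 0 \<Longrightarrow> norm (D y v) \<le> L * norm v"
    by (rule D_bounded) (rule that)
  have nG: "norm (G x) = norm x" for x
    using G_norm[of x] G0 by (cases "x = 0") (simp_all add: norm_eq)
  show thesis
  proof (rule that[of L])
    fix x y
    show "norm (G x - G y) \<le> L * norm (x - y)"
    proof (cases "0 \<in> closed_segment x y")
      case True
      then have "norm x + norm y = norm (x - y)"
        unfolding between_mem_segment[symmetric] between by (simp add: dist_norm)
      moreover have "norm (G x - G y) \<le> norm x + norm y"
        using norm_triangle_ineq4[of "G x" "G y"] nG by simp
      moreover have "1 * norm (x - y) \<le> L * norm (x - y)"
        using L(1) by (intro mult_right_mono) auto
      ultimately show ?thesis by linarith
    next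
      case False
      have z: "z \<noteq> 0" if "z \<in> closed_segment x y" for z
      proof
        assume "z = 0"
        then show False using that \<open>0 \<notin> closed_segment x y\<close> by simp
      qed
      show ?thesis
      proof (rule differentiable_bound[where f = G and S = "closed_segment x y" and f' = D])
        show "convex (closed_segment x y)" by simp
        show "(G has_derivative D z) (at z within closed_segment x y)" if "z \<in> closed_segment x y" for z
          by (rule has_derivative_at_withinI[OF G_deriv[OF z[OF that]]])
        show "onorm (D z) \<le> L" if "z \<in> closed_segment x y" for z
          by (rule onorm_le) (rule L(2)[OF z[OF that]])
        show "x \<in> closed_segment x y" "y \<in> closed_segment x y" by simp_all
      qed
    qed
  qed (use L in simp)
qed

text \<open>\<open>integral_curve\<close> asks for curves defined for all time, so the great circle
  hypothesis needs global solutions. They stay on the sphere because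
  \<open>x \<bullet> G x = 0\<close>.\<close>

lemma integral_curve_exists:
  assumes G0: "G 0 = 0" and p: "norm p = 1"
  obtains c where "c 0 = p" "\<And>t. norm (c t) = 1" "\<And>t. (c has_vector_derivative G (c t)) (at t)"
proof -
  obtain L where L: "L \<ge> 0" "\<And>x y. norm (G x - G y) \<le> L * norm (x - y)"
    by (rule G_lipschitz[OF G0]) (rule that)
  obtain c where c: "c 0 = p" "\<And>t. (c has_vector_derivative G (c t)) (at t)"
    by (rule global_ode_solution[OF L(2,1)]) (rule that)
  have orth: "x \<bullet> G x = 0" for x using G_orth[of x] G0 by (cases "x = 0") auto
  have "((\<lambda>t. c t \<bullet> c t) has_real_derivative 0) (at t)" for t
  proof -
    have "((\<lambda>t. c t \<bullet> c t) has_derivative (\<lambda>h. c t \<bullet> (h *\<^sub>R G (c t)) + (h *\<^sub>R G (c t)) \<bullet> c t)) (at t)"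
      using c(2)[of t] unfolding has_vector_derivative_def by (intro has_derivative_inner)
    then show ?thesis
      using orth[of "c t"] by (simp add: has_field_derivative_def inner_commute lambda_zero)
  qed
  then have "c t \<bullet> c t = c 0 \<bullet> c 0" for t
    using DERIV_isconst_all by blast
  then have "norm (c t) = 1" for t
    using p c(1) by (simp add: norm_eq_sqrt_inner)
  then show thesis by (rule that[OF c(1) _ c(2)])
qed

text \<open>The 2-plane of the great circle contains position, velocity and acceleration, so it is
  spanned by \<open>p\<close> and \<open>G p\<close>; \<open>G_D\<close> then reads off the
  coefficients of the acceleration \<open>D p (G p)\<close>.\<close>

lemma D_G_if_great_circles:
  assumes G0: "G 0 = 0" and p: "norm p = 1" and G\<zeta>: "\<And>x. norm x = 1 \<Longrightarrow> G x = \<zeta> x"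
    and gc: "\<forall>c. integral_curve \<zeta> c \<longrightarrow> great_circle (range c)"
  shows "D p (G p) = - p"
proof -
  have p0: "p \<noteq> 0" using p by auto
  have pp: "p \<bullet> p = 1" using p by (simp add: norm_eq_1)
  have gg: "G p \<bullet> G p = 1" using G_norm[OF p0] pp by simp
  obtain c where c: "c 0 = p" "\<And>t. norm (c t) = 1" "\<And>t. (c has_vector_derivative G (c t)) (at t)"
    by (rule integral_curve_exists[OF G0 p]) (rule that)
  have "integral_curve \<zeta> c"
    using c G\<zeta> by (simp add: integral_curve_def)
  then obtain W where W: "subspace W" "dim W = 2" "range c = W \<inter> S3"
    using gc by (auto simp: great_circle_def)
  have cW: "c t \<in> W" for t using W(3) by auto
  have GW: "G (c t) \<in> W" for t
    by (rule subspace_has_vector_derivative[OF W(1) cW c(3)])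
  have "((\<lambda>t. G (c t)) has_vector_derivative D p (G p)) (at 0)"
    using vector_derivative_diff_chain_within[OF c(3)[of 0] has_derivative_at_withinI[OF G_deriv], unfolded o_def]
      c(1) p0 by simp
  then have DW: "D p (G p) \<in> W"
    by (rule subspace_has_vector_derivative[OF W(1) GW])
  have ne: "p \<noteq> G p" "G p \<noteq> 0" using G_orth[OF p0] pp gg by auto
  have "independent {p, G p}"
    using G_orth[OF p0] ne p0
    by (intro pairwise_orthogonal_independent) (auto simp: pairwise_def orthogonal_def inner_commute)
  then have "W \<subseteq> span {p, G p}"
    using cW[of 0] GW[of 0] c(1) W(2) ne by (intro card_ge_dim_independent) auto
  then have "D p (G p) \<in> span {p, G p}" using DW by blast
  then obtain a where "D p (G p) - a *\<^sub>R p \<in> span {G p}"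
    unfolding span_breakdown_eq by blast
  then obtain b where "D p (G p) - a *\<^sub>R p = b *\<^sub>R G p"
    unfolding span_singleton by blast
  then have ab: "D p (G p) = a *\<^sub>R p + b *\<^sub>R G p"
    by (simp add: diff_eq_eq add.commute)
  have gp: "G p \<bullet> p = 0" using G_orth[OF p0] by (simp add: inner_commute)
  have "a = p \<bullet> D p (G p)" "b = G p \<bullet> D p (G p)"
    unfolding ab by (simp_all add: inner_add_right pp gg gp G_orth[OF p0])
  then have "a = - 1" "b = 0"
    by (simp_all add: G_D[OF p0] gg G_orth[OF p0])
  then show ?thesis using ab by simp
qed

lemma geod_facts:
  assumes p: "norm p = 1" and v: "v \<bullet> p = 0" "v \<bullet> v = 1"
  shows "norm (geod p v t) = 1"
    and "(geod p v has_vector_derivative (- sin t *\<^sub>R p + cos t *\<^sub>R v)) (at t)"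
proof -
  have "geod p v t \<bullet> geod p v t = (cos t)\<^sup>2 + (sin t)\<^sup>2"
    using p v by (simp add: geod_def inner_add_left inner_add_right inner_commute power2_eq_square norm_eq_1)
  then show "norm (geod p v t) = 1" by (simp add: norm_eq_1)
  show "(geod p v has_vector_derivative (- sin t *\<^sub>R p + cos t *\<^sub>R v)) (at t)"
    unfolding geod_def[abs_def] has_vector_derivative_def
    by (auto intro!: derivative_eq_intros simp: fun_eq_iff algebra_simps)
qed

text \<open>Compares the intrinsic with the flat second derivative. The term \<open>- G p\<close>
  comes from the acceleration \<open>- p\<close> of the geodesic and Euler's relation, the last term
  from differentiating the moving tangential projection.\<close>

lemma hess_eq:
  assumes p: "norm p = 1" and v: "v \<bullet> p = 0" "v \<bullet> v = 1" and G\<zeta>: "\<And>x. norm x = 1 \<Longrightarrow> G x = \<zeta> x"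
  shows "hess \<zeta> p v = B p v v - (B p v v \<bullet> p) *\<^sub>R p - G p + (v \<bullet> G p) *\<^sub>R v"
proof -
  have p0: "p \<noteq> 0" and pp: "p \<bullet> p = 1" using p by (auto simp: norm_eq_1)
  let ?\<gamma> = "geod p v"
  note g = geod_facts[OF p v]
  have g0: "?\<gamma> t \<noteq> 0" for t using g(1)[of t] by auto
  define Y where "Y t = - sin t *\<^sub>R D (?\<gamma> t) p + cos t *\<^sub>R D (?\<gamma> t) v" for t
  have "((\<lambda>s. \<zeta> (?\<gamma> s)) has_vector_derivative Y t) (at t)" for t
  proof -
    have "((\<lambda>s. G (?\<gamma> s)) has_vector_derivative D (?\<gamma> t) (- sin t *\<^sub>R p + cos t *\<^sub>R v)) (at t)"
      using vector_derivative_diff_chain_within[OF g(2)[of t] has_derivative_at_withinI[OF G_deriv[OF g0]]]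
      by (simp add: o_def)
    then show ?thesis using g(1) by (simp add: G\<zeta> Y_def lin_simps g0)
  qed
  then have vd: "vector_derivative (\<lambda>s. \<zeta> (?\<gamma> s)) (at t) = Y t" for t
    by (rule vector_derivative_at)
  have Dg: "((\<lambda>t. D (?\<gamma> t) w) has_vector_derivative B p v w) (at 0)" for w
    using vector_derivative_diff_chain_within[OF g(2)[of 0] has_derivative_at_withinI[OF D_deriv[OF g0]], of w]
    by (simp add: o_def geod_def)
  have Yd: "(Y has_vector_derivative B p v v - G p) (at 0)"
  proof -
    have "(Y has_vector_derivative
       (- sin 0 *\<^sub>R B p v p + - cos 0 *\<^sub>R D (?\<gamma> 0) p) + (cos 0 *\<^sub>R B p v v + - sin 0 *\<^sub>R D (?\<gamma> 0) v)) (at 0)"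
      unfolding Y_def[abs_def]
      by (intro has_vector_derivative_add has_vector_derivative_scaleR Dg) (auto intro!: derivative_eq_intros)
    then show ?thesis by (simp add: geod_def D_self[OF p0])
  qed
  have g0p: "?\<gamma> 0 = p" by (simp add: geod_def)
  have gd: "(?\<gamma> has_vector_derivative v) (at 0)" using g(2)[of 0] by simp
  have Y0: "Y 0 = D p v" by (simp add: Y_def geod_def)
  have "((\<lambda>t. Y t - (Y t \<bullet> ?\<gamma> t) *\<^sub>R ?\<gamma> t) has_vector_derivative
     (B p v v - G p) - ((Y 0 \<bullet> ?\<gamma> 0) *\<^sub>R v + (Y 0 \<bullet> v + (B p v v - G p) \<bullet> ?\<gamma> 0) *\<^sub>R ?\<gamma> 0)) (at 0)"
  proof (intro has_vector_derivative_diff has_vector_derivative_scaleR Yd gd)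
    show "((\<lambda>t. Y t \<bullet> ?\<gamma> t) has_real_derivative Y 0 \<bullet> v + (B p v v - G p) \<bullet> ?\<gamma> 0) (at 0)"
      using has_derivative_inner[OF Yd[unfolded has_vector_derivative_def] gd[unfolded has_vector_derivative_def]]
      unfolding has_field_derivative_def
      by (rule has_derivative_eq_rhs) (auto simp: fun_eq_iff algebra_simps)
  qed
  from vector_derivative_at[OF this]
  have "hess \<zeta> p v = tproj p ((B p v v - G p) - ((D p v \<bullet> p) *\<^sub>R v + (D p v \<bullet> v + (B p v v - G p) \<bullet> p) *\<^sub>R p))"
    unfolding hess_def vd[abs_def] tproj_def[of "?\<gamma> _"] Y0 g0p by simp
  moreover have "D p v \<bullet> p = - (v \<bullet> G p)"
    using G_D(1)[OF p0, of v] by (simp add: inner_commute)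
  ultimately show ?thesis
    using pp v G_orth[OF p0] by (simp add: tproj_def inner_simps inner_commute algebra_simps)
qed

lemma Lap_span_if_harmonic:
  assumes p: "norm p = 1" and G\<zeta>: "\<And>x. norm x = 1 \<Longrightarrow> G x = \<zeta> x" and harm: "harmonic_unit_field \<zeta>"
  shows "\<exists>a b. (\<Sum>e\<in>Basis. B p e e) = a *\<^sub>R p + b *\<^sub>R G p"
proof -
  have p0: "p \<noteq> 0" and pp: "p \<bullet> p = 1" using p by (auto simp: norm_eq_1)
  obtain f g where "onb4 p (G p) f g"
    using extend_onb4[of p "G p"] pp G_norm[OF p0] G_orth[OF p0] by auto
  \<comment> \<open>This frame only witnesses existence, so that the \<open>SOME\<close> in
    \<open>rough_laplacian\<close> and \<open>nabla_norm2\<close> selects a genuine tangent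
    frame.\<close>
  then have "tangent_onb p (\<lambda>i. [G p, f, g] ! i)"
    by (auto simp: tangent_onb_def onb4_def less_Suc_eq numeral_3_eq_3 inner_commute)
  then have on: "tangent_onb p (SOME e. tangent_onb p e)" by (rule someI[where P = "tangent_onb p"])
  define e where "e = (SOME e. tangent_onb p e)"
  have "tangent_onb p e" unfolding e_def by (rule on)
  then have "\<And>i. i < 3 \<Longrightarrow> e i \<bullet> p = 0" "\<And>i j. i < 3 \<Longrightarrow> j < 3 \<Longrightarrow> e i \<bullet> e j = (if i = j then 1 else 0)"
    by (auto simp: tangent_onb_def)
  note this[simp]
  have e: "e 0 \<bullet> p = 0" "e 1 \<bullet> p = 0" "e 2 \<bullet> p = 0" "e 0 \<bullet> e 0 = 1" "e 1 \<bullet> e 1 = 1" "e 2 \<bullet> e 2 = 1"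
    "e 0 \<bullet> e 1 = 0" "e 0 \<bullet> e 2 = 0" "e 1 \<bullet> e 2 = 0"
    by simp_all
  then have o: "onb4 p (e 0) (e 1) (e 2)"
    using pp by (simp add: onb4_def inner_commute)
  obtain x y z where xyz: "x = e 0" "y = e 1" "z = e 2" by blast
  have o: "onb4 p x y z" unfolding xyz by (rule o)
  note oo = o[unfolded onb4_def]
  let ?S = "\<Sum>b\<in>Basis. B p b b"
  \<comment> \<open>The radial entry \<open>B p p p\<close> vanishes, so the trace over the tangent
    frame is the full Laplacian.\<close>
  have tr: "?S = B p x x + B p y y + B p z z"
    by (subst trace_onb4[OF o]) (simp_all add: linear_B1 linear_B2 p0 B_self)
  have Gp: "G p = (x \<bullet> G p) *\<^sub>R x + (y \<bullet> G p) *\<^sub>R y + (z \<bullet> G p) *\<^sub>R z"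
    using onb4_expand[OF o, of "G p"] G_orth[OF p0] by (simp add: inner_commute)
  have hess: "hess \<zeta> p v = B p v v - (B p v v \<bullet> p) *\<^sub>R p - G p + (v \<bullet> G p) *\<^sub>R v"
    if "v = x \<or> v = y \<or> v = z" for v
    by (rule hess_eq[OF p _ _ G\<zeta>]) (use that oo in \<open>auto simp: inner_commute\<close>)
  have "hess \<zeta> p x + hess \<zeta> p y + hess \<zeta> p z = ?S - (?S \<bullet> p) *\<^sub>R p - G p - G p - G p
      + ((x \<bullet> G p) *\<^sub>R x + (y \<bullet> G p) *\<^sub>R y + (z \<bullet> G p) *\<^sub>R z)"
    unfolding tr inner_add_left scaleR_add_left by (simp add: hess)
  also have "\<dots> = ?S - (?S \<bullet> p) *\<^sub>R p - G p - G p - G p + G p"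
    unfolding Gp[symmetric] ..
  also have "hess \<zeta> p x + hess \<zeta> p y + hess \<zeta> p z = rough_laplacian \<zeta> p"
    by (simp add: rough_laplacian_def Let_def e_def[symmetric] numeral_3_eq_3 numeral_2_eq_2 xyz)
  finally have rl: "rough_laplacian \<zeta> p = ?S - (?S \<bullet> p) *\<^sub>R p - G p - G p - G p + G p" .
  let ?n = "nabla_norm2 \<zeta> p"
  have "?S = (?S - (?S \<bullet> p) *\<^sub>R p - G p - G p - G p + G p + ?n *\<^sub>R G p)
      + ((?S \<bullet> p) *\<^sub>R p + (G p + G p - ?n *\<^sub>R G p))"
    by simp
  also have "?S - (?S \<bullet> p) *\<^sub>R p - G p - G p - G p + G p + ?n *\<^sub>R G p = 0"
    using harm p G\<zeta>[OF p] unfolding rl[symmetric] by (simp add: harmonic_unit_field_def)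
  also have "G p + G p - ?n *\<^sub>R G p = (2 - ?n) *\<^sub>R G p"
    by (simp add: scaleR_left_diff_distrib scaleR_2)
  finally have "?S = (?S \<bullet> p) *\<^sub>R p + (2 - ?n) *\<^sub>R G p" by simp
  then show ?thesis by blast
qed

end

section \<open>Conclusion\<close>

lemma hom_ext_0 [simp]: "hom_ext f 0 = 0"
  by (simp add: hom_ext_def)

lemma hom_ext_scale:
  assumes "s > 0"
  shows "hom_ext f (s *\<^sub>R y) = s *\<^sub>R hom_ext f y"
proof -
  have "inverse (norm (s *\<^sub>R y)) * s = inverse (norm y)"
    using assms by simp
  then have eq: "(s *\<^sub>R y) /\<^sub>R norm (s *\<^sub>R y) = y /\<^sub>R norm y"
    unfolding scaleR_scaleR by (rule arg_cong)
  show ?thesis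
    unfolding hom_ext_def eq using assms by simp
qed

lemma smooth_unit_field_ext:
  assumes "smooth_unit_field_S3 \<zeta>"
  obtains D B C where "unit_field_ext (hom_ext \<zeta>) D B C"
proof -
  let ?G = "hom_ext \<zeta>" and ?S = "- {0 :: real^4}"
  obtain U F where U: "open U" "S3 \<subseteq> U" "smooth_on U F" "\<And>p. p \<in> S3 \<Longrightarrow> F p = \<zeta> p"
    and unit: "\<And>p. p \<in> S3 \<Longrightarrow> \<zeta> p \<bullet> p = 0" "\<And>p. p \<in> S3 \<Longrightarrow> norm (\<zeta> p) = 1"
    using assms unfolding smooth_unit_field_S3_def by blast
  have Ck: "Ck_on k ?S ?G" for k
    by (rule Ck_on_hom_ext[OF U(1,2), where F = F]) (use U(3,4) in \<open>simp_all add: smooth_on_def\<close>)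
  have S: "open ?S" by auto
  define D where "D y = frechet_derivative ?G (at y)" for y
  define B where "B y u v = frechet_derivative (\<lambda>y. D y v) (at y) u" for y u v
  define C where "C y w u v = frechet_derivative (\<lambda>y. B y u v) (at y) w" for y w u v
  have C0: "Ck_on (Suc (Suc (Suc 0))) ?S ?G" by (rule Ck)
  have C1: "Ck_on (Suc (Suc 0)) ?S (\<lambda>y. D y v)" for v
    using C0 unfolding D_def Ck_on.simps(2)[of "Suc (Suc 0)"] by blast
  have C2: "Ck_on (Suc 0) ?S (\<lambda>y. B y u v)" for u v
    using C1 unfolding B_def Ck_on.simps(2)[of "Suc 0"] by blast
  have C3: "continuous_on ?S (\<lambda>y. C y w u v)" for w u v
    using C2 unfolding C_def Ck_on.simps by blast
  have C2': "continuous_on ?S (\<lambda>y. B y u v)" for u v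
    using Ck_on_Suc_imp[OF C2] by simp
  have D: "(?G has_derivative D y) (at y)" if "y \<noteq> 0" for y
    using Ck_on_has_derivative[OF S C0, of y] that by (simp add: D_def)
  have B: "((\<lambda>y. D y v) has_derivative (\<lambda>u. B y u v)) (at y)" if "y \<noteq> 0" for y v
    using Ck_on_has_derivative[OF S C1, of y] that by (simp add: B_def)
  have C: "((\<lambda>y. B y u v) has_derivative (\<lambda>w. C y w u v)) (at y)" if "y \<noteq> 0" for y u v
    using Ck_on_has_derivative[OF S C2, of y] that by (simp add: C_def)
  have "unit_field_ext ?G D B C"
  proof
    fix y :: "real^4" assume y: "y \<noteq> 0"
    then have yS: "y \<in> ?S" by simp
    show "(?G has_derivative D y) (at y)" by (rule D[OF y])
    show "((\<lambda>y. D y v) has_derivative (\<lambda>u. B y u v)) (at y)" for v by (rule B[OF y])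
    show "((\<lambda>y. B y u v) has_derivative (\<lambda>w. C y w u v)) (at y)" for u v by (rule C[OF y])
    show "B y u v = B y v u" for u v
      by (rule symmetric_second_derivative[OF S yS, where g = ?G and g' = D
            and gu = "\<lambda>y w. B y w v" and gv = "\<lambda>y w. B y w u"])
        (use D B C2' in auto)
    \<comment> \<open>Schwarz's theorem for the first derivative \<open>D y v\<close> with
      \<open>v\<close> fixed.\<close>
    show "C y w u v = C y u w v" for w u v
      by (rule symmetric_second_derivative[OF S yS, where g = "\<lambda>y. D y v" and g' = "\<lambda>y u. B y u v"
            and gu = "\<lambda>y w. C y w u v" and gv = "\<lambda>y u. C y u w v"])
        (use B C C3 in auto)
    show "?G (s *\<^sub>R y) = s *\<^sub>R ?G y" if "s > 0" for s
      using that by (rule hom_ext_scale)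
    have p: "y /\<^sub>R norm y \<in> S3" using y by (simp add: dist_norm)
    have yp: "y = norm y *\<^sub>R (y /\<^sub>R norm y)" using y by simp
    have "(y /\<^sub>R norm y) \<bullet> \<zeta> (y /\<^sub>R norm y) = 0"
      using unit(1)[OF p] by (simp only: inner_commute)
    then show "y \<bullet> ?G y = 0"
      using y by (simp add: hom_ext_def)
    have "norm (?G y) = norm y"
      using unit(2)[OF p] by (simp add: hom_ext_def)
    then show "?G y \<bullet> ?G y = y \<bullet> y"
      by (simp add: dot_square_norm)
  qed
  then show thesis by (rule that)
qed

lemma hopf_field_if_linear:
  fixes J :: "real^4 \<Rightarrow> real^4"
  assumes J: "linear J" "\<And>y. J (J y) = - y" "\<And>y. norm (J y) = norm y"
    and \<zeta>: "\<And>p. p \<in> S3 \<Longrightarrow> \<zeta> p = J p"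
  shows "hopf_field \<zeta>"
proof -
  have "orthogonal_matrix (matrix J)"
    using J(1,3) orthogonal_transformation orthogonal_transformation_matrix by blast
  moreover have mJ: "matrix J *v x = J x" for x
    using J(1) by (simp add: matrix_works)
  have "(- mat 1 :: real^4^4) *v x = - x" for x
    using matrix_vector_mult_diff_rdistrib[of 0 "mat 1 :: real^4^4" x] by simp
  then have "matrix J ** matrix J = - mat 1"
    unfolding matrix_eq by (simp add: matrix_vector_mul_assoc[symmetric] mJ J(2))
  ultimately show ?thesis
    unfolding hopf_field_def using mJ \<zeta> by auto
qed

theorem theoremC:
  fixes \<zeta> :: "real^4 \<Rightarrow> real^4"
  assumes "smooth_unit_field_S3 \<zeta>"
    and "harmonic_unit_field \<zeta>"
    and "\<forall>c. integral_curve \<zeta> c \<longrightarrow> great_circle (range c)"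
  shows "hopf_field \<zeta>"
proof -
  let ?G = "hom_ext \<zeta>"
  obtain D B C where "unit_field_ext ?G D B C"
    using smooth_unit_field_ext[OF assms(1)] .
  then interpret unit_field_ext ?G D B C .
  note sphere = hom_ext_sphere[of _ \<zeta>]
  interpret harmonic_geodesic_ext ?G D B C
  proof
    fix p :: "real^4" assume p: "norm p = 1"
    show "D p (?G p) = - p"
      by (rule D_G_if_great_circles[OF hom_ext_0 p sphere assms(3)])
    show "\<exists>a b. (\<Sum>e\<in>Basis. B p e e) = a *\<^sub>R p + b *\<^sub>R ?G p"
      by (rule Lap_span_if_harmonic[OF p sphere assms(2)])
  qed
  obtain J where J: "linear J" "\<And>y. y \<noteq> 0 \<Longrightarrow> ?G y = J y" "\<And>y. J (J y) = - y"
    by (rule linear_complex_structure) (rule that)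
  show ?thesis
  proof (rule hopf_field_if_linear[OF J(1,3)])
    show "norm (J y) = norm y" for y
      using G_norm[of y] J(2)[of y] linear_0[OF J(1)] by (cases "y = 0") (auto simp: norm_eq)
    show "\<zeta> p = J p" if "p \<in> S3" for p
    proof -
      have "norm p = 1" using that by simp
      then have "p \<noteq> 0" by auto
      then show ?thesis using J(2)[of p] sphere[OF \<open>norm p = 1\<close>] by simp
    qed
  qed
qed

end
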